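(* Let $g\ge1$ and let $\Sigma_g$ be the compact, connected, orientable smooth surface of genus $g$ without boundary. For a given conformal class of metrics $[h]$ on $\Sigma_g$ and a given closed $1$-form $A$ on $\Sigma_g$, $$\inf_{h'\in[h]}|h'|\,\lambda_1(\Sigma_g,h',A)=0 .$$
   Context: For a smooth real $1$-form $A$ on a compact Riemannian manifold $(M,h)$ without boundary, $\lambda_1(M,h,A)$ denotes the lowest eigenvalue of the magnetic Laplacian $\Delta_A=(d^A)^*d^A$, where $d^Au=du-iuA$; i.e. $$\lambda_1(M,h,A)=\min_{0\neq u\in C^\infty(M,\mathbb C)}\frac{\int_M|du-iuA|_h^2\,dv_h}{\int_M|u|^2dv_h}.$$ $|h|$ is the volume (area) of $(\Sigma_g,h)$ and $[h]$ is the set of metrics $fh$ with $f$ a positive smooth function. *)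

theory Defs
  imports "HOL-Analysis.Analysis" "HOL-Homology.Homology"
begin

primrec Ck_on :: "nat \<Rightarrow> 'a::real_normed_vector set \<Rightarrow> ('a \<Rightarrow> 'b::real_normed_vector) \<Rightarrow> bool" where
  "Ck_on 0 S f \<longleftrightarrow> continuous_on S f"
| "Ck_on (Suc k) S f \<longleftrightarrow>
     (\<forall>x\<in>S. f differentiable (at x)) \<and>
     (\<forall>v. Ck_on k S (\<lambda>x. frechet_derivative f (at x) v))"

text \<open>Only meaningful for open domains, where it is the usual notion of a smooth map.\<close>

definition smooth_on :: "'a::real_normed_vector set \<Rightarrow> ('a \<Rightarrow> 'b::real_normed_vector) \<Rightarrow> bool" where
  "smooth_on S f \<longleftrightarrow> (\<forall>k. Ck_on k S f)"

text \<open>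
  A chart is a coordinate domain together with a coordinate map; the values of the map off the
  domain are irrelevant.
\<close>

type_synonym 'a chart = "'a set \<times> ('a \<Rightarrow> real^2)"

abbreviation chart_dom :: "'a chart \<Rightarrow> 'a set" where
  "chart_dom c \<equiv> fst c"

abbreviation chart_map :: "'a chart \<Rightarrow> 'a \<Rightarrow> real^2" where
  "chart_map c \<equiv> snd c"

definition chart_img :: "'a chart \<Rightarrow> (real^2) set" where
  "chart_img c = chart_map c ` chart_dom c"

definition chart_inv :: "'a chart \<Rightarrow> real^2 \<Rightarrow> 'a" where
  "chart_inv c = inv_into (chart_dom c) (chart_map c)"

definition is_chart :: "'a topology \<Rightarrow> 'a chart \<Rightarrow> bool" where
  "is_chart X c \<longleftrightarrow>
     openin X (chart_dom c) \<and> open (chart_img c) \<and>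
     homeomorphic_map (subtopology X (chart_dom c)) (top_of_set (chart_img c)) (chart_map c)"

definition overlap :: "'a chart \<Rightarrow> 'a chart \<Rightarrow> (real^2) set" where
  "overlap c d = chart_map c ` (chart_dom c \<inter> chart_dom d)"

definition transition :: "'a chart \<Rightarrow> 'a chart \<Rightarrow> real^2 \<Rightarrow> real^2" where
  "transition c d = chart_map d \<circ> chart_inv c"

definition jacobian :: "'a chart \<Rightarrow> 'a chart \<Rightarrow> real^2 \<Rightarrow> real^2^2" where
  "jacobian c d x = matrix (frechet_derivative (transition c d) (at x))"

definition compatible :: "'a chart \<Rightarrow> 'a chart \<Rightarrow> bool" where
  "compatible c d \<longleftrightarrow>
     smooth_on (overlap c d) (transition c d) \<and> smooth_on (overlap d c) (transition d c)"

definition smooth_atlas :: "'a topology \<Rightarrow> 'a chart set \<Rightarrow> bool" where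
  "smooth_atlas X \<A> \<longleftrightarrow>
     (\<forall>c\<in>\<A>. is_chart X c) \<and> topspace X \<subseteq> (\<Union>c\<in>\<A>. chart_dom c) \<and>
     (\<forall>c\<in>\<A>. \<forall>d\<in>\<A>. compatible c d)"

definition smooth_structure :: "'a topology \<Rightarrow> 'a chart set \<Rightarrow> bool" where
  "smooth_structure X \<A> \<longleftrightarrow>
     smooth_atlas X \<A> \<and> (\<forall>c. is_chart X c \<and> (\<forall>d\<in>\<A>. compatible c d) \<longrightarrow> c \<in> \<A>)"

definition smooth_surface :: "'a topology \<Rightarrow> 'a chart set \<Rightarrow> bool" where
  "smooth_surface X \<A> \<longleftrightarrow> Hausdorff_space X \<and> second_countable X \<and> smooth_structure X \<A>"

definition orientable :: "'a topology \<Rightarrow> 'a chart set \<Rightarrow> bool" where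
  "orientable X \<A> \<longleftrightarrow>
     (\<exists>\<B>\<subseteq>\<A>. topspace X \<subseteq> (\<Union>c\<in>\<B>. chart_dom c) \<and>
        (\<forall>c\<in>\<B>. \<forall>d\<in>\<B>. \<forall>x\<in>overlap c d. det (jacobian c d x) > 0))"

text \<open>
  The genus of a closed connected orientable surface is half the rank of its first integral
  homology group, which is free abelian of rank \<open>2 * g\<close>.
\<close>

definition has_genus :: "'a topology \<Rightarrow> nat \<Rightarrow> bool" where
  "has_genus X g \<longleftrightarrow> homology_group 1 X \<cong> free_Abelian_group {..<2 * g}"

definition smooth_fun :: "'a chart set \<Rightarrow> ('a \<Rightarrow> 'b::real_normed_vector) \<Rightarrow> bool" where
  "smooth_fun \<A> f \<longleftrightarrow> (\<forall>c\<in>\<A>. smooth_on (chart_img c) (f \<circ> chart_inv c))"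

text \<open>
  Tensor fields are given by their components in every chart, as functions of the coordinates,
  subject to the transformation law. Component functions are constrained only on the image of
  the chart, and only their values there are ever used.
\<close>

type_synonym 'a form = "'a chart \<Rightarrow> real^2 \<Rightarrow> real^2"
type_synonym 'a metric_field = "'a chart \<Rightarrow> real^2 \<Rightarrow> real^2^2"

definition one_form :: "'a chart set \<Rightarrow> 'a form \<Rightarrow> bool" where
  "one_form \<A> A \<longleftrightarrow>
     (\<forall>c\<in>\<A>. smooth_on (chart_img c) (A c)) \<and>
     (\<forall>c\<in>\<A>. \<forall>d\<in>\<A>. \<forall>x\<in>overlap c d.
        A c x = transpose (jacobian c d x) *v A d (transition c d x))"

definition partial :: "(real^2 \<Rightarrow> 'b::real_normed_vector) \<Rightarrow> 2 \<Rightarrow> real^2 \<Rightarrow> 'b" where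
  "partial f i x = frechet_derivative f (at x) (axis i 1)"

definition closed_one_form :: "'a chart set \<Rightarrow> 'a form \<Rightarrow> bool" where
  "closed_one_form \<A> A \<longleftrightarrow>
     one_form \<A> A \<and>
     (\<forall>c\<in>\<A>. \<forall>x\<in>chart_img c. \<forall>i j. partial (\<lambda>y. A c y $ j) i x = partial (\<lambda>y. A c y $ i) j x)"

definition riemannian_metric :: "'a chart set \<Rightarrow> 'a metric_field \<Rightarrow> bool" where
  "riemannian_metric \<A> h \<longleftrightarrow>
     (\<forall>c\<in>\<A>. smooth_on (chart_img c) (h c)) \<and>
     (\<forall>c\<in>\<A>. \<forall>x\<in>chart_img c. transpose (h c x) = h c x \<and> (\<forall>v. v \<noteq> 0 \<longrightarrow> v \<bullet> (h c x *v v) > 0)) \<and>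
     (\<forall>c\<in>\<A>. \<forall>d\<in>\<A>. \<forall>x\<in>overlap c d.
        h c x = transpose (jacobian c d x) ** h d (transition c d x) ** jacobian c d x)"

definition conformal_class :: "'a topology \<Rightarrow> 'a chart set \<Rightarrow> 'a metric_field \<Rightarrow> 'a metric_field set" where
  "conformal_class X \<A> h =
     {h'. \<exists>f :: 'a \<Rightarrow> real. smooth_fun \<A> f \<and> (\<forall>p\<in>topspace X. f p > 0) \<and>
          h' = (\<lambda>c x. f (chart_inv c x) *\<^sub>R h c x)}"

text \<open>
  The unique Borel measure given by \<open>sqrt (det h) dx\<close> in every chart. Existence is the
  change of variables formula; uniqueness holds because countably many charts cover.
\<close>

definition volume_measure :: "'a topology \<Rightarrow> 'a chart set \<Rightarrow> 'a metric_field \<Rightarrow> 'a measure" where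
  "volume_measure X \<A> h =
     (THE \<mu>. space \<mu> = topspace X \<and>
             sets \<mu> = sigma_sets (topspace X) {U. openin X U} \<and>
             (\<forall>c\<in>\<A>. \<forall>B\<in>sets \<mu>. B \<subseteq> chart_dom c \<longrightarrow>
                emeasure \<mu> B =
                  (\<integral>\<^sup>+x\<in>chart_map c ` B. ennreal (sqrt (det (h c x))) \<partial>lborel)))"

definition area :: "'a topology \<Rightarrow> 'a chart set \<Rightarrow> 'a metric_field \<Rightarrow> real" where
  "area X \<A> h = measure (volume_measure X \<A> h) (topspace X)"

text \<open>Components in the chart \<open>c\<close>, at coordinates \<open>x\<close>, of \<open>du - iuA\<close>.\<close>

definition magnetic_diff :: "'a form \<Rightarrow> ('a \<Rightarrow> complex) \<Rightarrow> 'a chart \<Rightarrow> real^2 \<Rightarrow> complex^2" where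
  "magnetic_diff A u c x =
     (\<chi> i. partial (u \<circ> chart_inv c) i x - \<i> * u (chart_inv c x) * of_real (A c x $ i))"

definition covector_norm2 :: "real^2^2 \<Rightarrow> complex^2 \<Rightarrow> real" where
  "covector_norm2 H \<omega> = (\<Sum>i\<in>UNIV. \<Sum>j\<in>UNIV. matrix_inv H $ i $ j * Re (\<omega> $ i * cnj (\<omega> $ j)))"

text \<open>
  The squared pointwise \<open>h\<close>-norm of \<open>du - iuA\<close>, computed in an arbitrary chart around the
  point; by the transformation laws the value does not depend on that chart.
\<close>

definition magnetic_energy_density ::
    "'a chart set \<Rightarrow> 'a metric_field \<Rightarrow> 'a form \<Rightarrow> ('a \<Rightarrow> complex) \<Rightarrow> 'a \<Rightarrow> real" where
  "magnetic_energy_density \<A> h A u p =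
     (let c = (SOME c. c \<in> \<A> \<and> p \<in> chart_dom c); x = chart_map c p
      in covector_norm2 (h c x) (magnetic_diff A u c x))"

definition rayleigh_quotient ::
    "'a topology \<Rightarrow> 'a chart set \<Rightarrow> 'a metric_field \<Rightarrow> 'a form \<Rightarrow> ('a \<Rightarrow> complex) \<Rightarrow> real" where
  "rayleigh_quotient X \<A> h A u =
     (\<integral>p. magnetic_energy_density \<A> h A u p \<partial>volume_measure X \<A> h) /
     (\<integral>p. (cmod (u p))\<^sup>2 \<partial>volume_measure X \<A> h)"

text \<open>
  The lowest eigenvalue of the magnetic Laplacian, by its variational definition. On a closed
  surface the infimum is attained, so it is the minimum.
\<close>

definition lambda1 :: "'a topology \<Rightarrow> 'a chart set \<Rightarrow> 'a metric_field \<Rightarrow> 'a form \<Rightarrow> real" where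
  "lambda1 X \<A> h A =
     (INF u\<in>{u. smooth_fun \<A> u \<and> (\<exists>p\<in>topspace X. u p \<noteq> 0)}. rayleigh_quotient X \<A> h A u)"

end

theory Submission
  imports Defs
begin

text \<open>
  In dimension two the Dirichlet energy is conformally invariant while the \<open>L\<^sup>2\<close> norm is not. Points of a
  surface have zero capacity, so near a point there are cutoffs \<open>v\<close>, equal to \<open>1\<close> close to that point, for
  which \<open>\<integral>|dv|\<^sup>2 + v\<^sup>2\<close> is arbitrarily small; for real \<open>v\<close> one has \<open>|dv - ivA|\<^sup>2 = |dv|\<^sup>2 + v\<^sup>2|A|\<^sup>2\<close>, so
  the magnetic energy of \<open>v\<close> is arbitrarily small too. Take the conformal factor \<open>f = \<delta> + \<psi>\<close> with a bump
  \<open>\<psi>\<close> supported where \<open>v = 1\<close>. For small \<open>\<delta>\<close> the area of \<open>fh\<close> is at most twice the squared norm of \<open>v\<close>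
  with respect to \<open>fh\<close>, hence area times Rayleigh quotient is at most twice the energy of \<open>v\<close>.
\<close>

section \<open>Smooth functions and cutoffs\<close>

text \<open>The constant test function fails in general: its energy is the integral of |A|^2,
  whatever the conformal factor. So a function of small energy has to be built first, with
  \<open>h\<close> alone in view, and the conformal factor is fitted to it afterwards. The bump by
  itself is no admissible factor, since a conformal factor must be positive on all of the surface;
  this is the reason for \<delta>. The logarithmic function usually used for zero capacity is not
  smooth. An average of one smooth cutoff over geometrically shrinking scales replaces it. Two
  features of the definitions cost much of the length. The volume measure is specified only by its
  values on sets inside a chart, so it must be constructed and shown unique before anything can be
  integrated. The energy density is evaluated in an arbitrarily chosen chart, so independence of
  that choice has to precede any estimate in the chart that carries the cutoff.\<close>

lemma Ck_on_Suc_imp: "Ck_on (Suc k) S f \<Longrightarrow> Ck_on k S f"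
proof (induction k arbitrary: f)
  case 0
  then show ?case
    by (auto intro!: differentiable_imp_continuous_on differentiable_at_imp_differentiable_on)
next
  case (Suc k)
  then show ?case by (metis Ck_on.simps(2))
qed

text \<open>Derivatives are taken along the full filter \<open>at x\<close>; agreement on
  \<open>S\<close> passes to them because \<open>S\<close> is open.\<close>

lemma Ck_on_cong:
  assumes "open S" "\<And>x. x \<in> S \<Longrightarrow> f x = g x" "Ck_on k S f"
  shows "Ck_on k S g"
  using assms(2,3)
proof (induction k arbitrary: f g)
  case 0
  then show ?case by (auto intro: continuous_on_eq)
next
  case (Suc k)
  have d: "f differentiable (at x)" if "x \<in> S" for x
    using Suc.prems that by simp
  have hd: "(g has_derivative frechet_derivative f (at x)) (at x)" if "x \<in> S" for x
    using d[OF that] unfolding frechet_derivative_works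
    by (rule has_derivative_transform_within_open[OF _ assms(1) that]) (simp add: Suc.prems)
  then have fd: "frechet_derivative f (at x) = frechet_derivative g (at x)" if "x \<in> S" for x
    using that frechet_derivative_at by blast
  have "Ck_on k S (\<lambda>x. frechet_derivative g (at x) v)" for v
    by (rule Suc.IH[of "\<lambda>x. frechet_derivative f (at x) v"]) (use fd Suc.prems in auto)
  then show ?case using hd by (auto simp: differentiable_def)
qed

text \<open>Neighbourhoods decide continuity, differentiability and the derivative at each point.
  This serves functions given by different formulas on different regions.\<close>

lemma Ck_on_local:
  assumes "\<And>x. x \<in> S \<Longrightarrow> \<exists>U. open U \<and> x \<in> U \<and> Ck_on k U f"
  shows "Ck_on k S f"
  using assms
proof (induction k arbitrary: f)
  case 0
  then show ?case
    by simp (meson continuous_at_imp_continuous_on continuous_on_eq_continuous_at)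
next
  case (Suc k)
  have "\<forall>x\<in>S. f differentiable (at x)"
    using Suc.prems by fastforce
  moreover have "Ck_on k S (\<lambda>x. frechet_derivative f (at x) v)" for v
    by (rule Suc.IH) (use Suc.prems in fastforce)
  ultimately show ?case by simp
qed

text \<open>Lets the inductions below use an explicit formula for the derivative in place of
  \<open>frechet_derivative\<close>.\<close>

lemma Ck_on_SucI:
  assumes "open S" "\<And>x. x \<in> S \<Longrightarrow> (f has_derivative f' x) (at x)"
    and "\<And>v. Ck_on k S (\<lambda>x. f' x v)"
  shows "Ck_on (Suc k) S f"
proof -
  have "frechet_derivative f (at x) = f' x" if "x \<in> S" for x
    using assms(2)[OF that] frechet_derivative_at by metis
  then have "Ck_on k S (\<lambda>x. frechet_derivative f (at x) v)" for v
    by (intro Ck_on_cong[OF assms(1) _ assms(3)[of v]]) simp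
  then show ?thesis using assms(2) by (auto simp: differentiable_def)
qed

lemma Ck_on_SucD:
  assumes "Ck_on (Suc k) S f"
  shows "x \<in> S \<Longrightarrow> (f has_derivative frechet_derivative f (at x)) (at x)"
    and "Ck_on k S (\<lambda>x. frechet_derivative f (at x) v)"
  using assms by (auto simp: frechet_derivative_works[symmetric])

lemma Ck_on_const: "Ck_on k S (\<lambda>x. c)"
  by (induction k arbitrary: c) auto

lemma Ck_on_add:
  assumes "open S" "Ck_on k S f" "Ck_on k S g"
  shows "Ck_on k S (\<lambda>x. f x + g x)"
  using assms(2,3)
proof (induction k arbitrary: f g)
  case (Suc k)
  show ?case
    by (rule Ck_on_SucI[OF assms(1)], rule has_derivative_add)
       (use Suc Ck_on_SucD in blast)+
qed (auto intro: continuous_intros)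

lemma Ck_on_sum:
  assumes "open S" "\<And>i. i \<in> I \<Longrightarrow> Ck_on k S (f i)"
  shows "Ck_on k S (\<lambda>x. \<Sum>i\<in>I. f i x)"
  using assms(2) by (induction I rule: infinite_finite_induct) (auto intro: Ck_on_const Ck_on_add[OF assms(1)])

text \<open>By the product rule the derivative is a sum of two terms of the same shape and one order
  less, hence the induction with \<open>f\<close> and \<open>g\<close> arbitrary. Products, scalar
  multiples and inner products are all instances.\<close>

lemma Ck_on_bilinear:
  assumes B: "bounded_bilinear B" and S: "open S" and "Ck_on k S f" "Ck_on k S g"
  shows "Ck_on k S (\<lambda>x. B (f x) (g x))"
  using assms(3,4)
proof (induction k arbitrary: f g)
  case 0
  then show ?case by (simp add: bounded_bilinear.continuous_on[OF B])
next
  case (Suc k)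
  show ?case
  proof (rule Ck_on_SucI[OF S])
    fix x assume "x \<in> S"
    then show "((\<lambda>x. B (f x) (g x)) has_derivative
      (\<lambda>v. B (f x) (frechet_derivative g (at x) v) + B (frechet_derivative f (at x) v) (g x))) (at x)"
      by (intro bounded_bilinear.FDERIV[OF B]) (use Suc.prems Ck_on_SucD in blast)+
  next
    show "Ck_on k S (\<lambda>x. B (f x) (frechet_derivative g (at x) v) + B (frechet_derivative f (at x) v) (g x))" for v
      using Suc.prems by (intro Ck_on_add[OF S] Suc.IH Ck_on_SucD) (auto intro: Ck_on_Suc_imp simp del: Ck_on.simps)
  qed
qed

lemma Ck_on_linear:
  assumes "bounded_linear L"
  shows "Ck_on k S L"
proof (cases k)
  case 0
  then show ?thesis by (simp add: assms linear_continuous_on)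
next
  case (Suc n)
  have "frechet_derivative L (at x) = L" for x
    using bounded_linear_imp_has_derivative[OF assms] frechet_derivative_at by metis
  then show ?thesis unfolding Suc
    using assms bounded_linear_imp_differentiable by (auto intro: Ck_on_const)
qed

text \<open>In the chain rule the direction in which \<open>g\<close> is differentiated varies with
  \<open>x\<close>, so the induction hypothesis does not apply directly. Expanding that direction in
  the basis of \<open>'b\<close> leaves derivatives of \<open>g\<close> in fixed directions,
  composed with \<open>f\<close>, times coefficients that are derivatives of
  \<open>f\<close>.\<close>

lemma Ck_on_compose:
  fixes f :: "'a::real_normed_vector \<Rightarrow> 'b::euclidean_space"
  assumes S: "open S" and "Ck_on k S f" "Ck_on k T g" and "f ` S \<subseteq> T"
  shows "Ck_on k S (\<lambda>x. g (f x))"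
  using assms(2-4)
proof (induction k arbitrary: f g)
  case 0
  then show ?case using continuous_on_compose2[of T g S f] by simp
next
  case (Suc k)
  let ?D = "\<lambda>x v. frechet_derivative g (at (f x)) (frechet_derivative f (at x) v)"
  have g: "(g has_derivative frechet_derivative g (at (f x))) (at (f x))" if "x \<in> S" for x
    using Ck_on_SucD(1)[OF Suc.prems(2)] Suc.prems(3) that by blast
  have lin: "linear (frechet_derivative g (at (f x)))" if "x \<in> S" for x
    using g[OF that] has_derivative_linear by blast
  show ?case
  proof (rule Ck_on_SucI[OF S])
    fix x assume "x \<in> S"
    then show "((\<lambda>x. g (f x)) has_derivative ?D x) (at x)"
      using diff_chain_at[OF Ck_on_SucD(1)[OF Suc.prems(1)] g] by (simp add: o_def)
  next
    fix v
    let ?S = "\<lambda>x. \<Sum>b\<in>Basis. (frechet_derivative f (at x) v \<bullet> b) *\<^sub>R frechet_derivative g (at (f x)) b"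
    have "Ck_on k S ?S"
    proof (intro Ck_on_sum[OF S] Ck_on_bilinear[OF bounded_bilinear_scaleR S])
      fix b :: 'b
      show "Ck_on k S (\<lambda>x. frechet_derivative f (at x) v \<bullet> b)"
        by (intro Ck_on_bilinear[OF bounded_bilinear_inner S] Ck_on_const Ck_on_SucD(2)[OF Suc.prems(1)])
      show "Ck_on k S (\<lambda>x. frechet_derivative g (at (f x)) b)"
        by (intro Suc.IH Ck_on_SucD(2)[OF Suc.prems(2)] Ck_on_Suc_imp[OF Suc.prems(1)] Suc.prems(3))
    qed
    moreover have "?S x = ?D x v" if "x \<in> S" for x
    proof -
      have "?D x v = frechet_derivative g (at (f x)) (\<Sum>b\<in>Basis. (frechet_derivative f (at x) v \<bullet> b) *\<^sub>R b)"
        by (simp only: euclidean_representation)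
      also have "\<dots> = ?S x"
        by (simp only: linear_sum[OF lin[OF that]] linear_scale[OF lin[OF that]])
      finally show ?thesis by simp
    qed
    ultimately show "Ck_on k S (\<lambda>x. ?D x v)"
      by (intro Ck_on_cong[OF S, of ?S "\<lambda>x. ?D x v"])
  qed
qed

lemma smooth_on_cong:
  "open S \<Longrightarrow> (\<And>x. x \<in> S \<Longrightarrow> f x = g x) \<Longrightarrow> smooth_on S f \<Longrightarrow> smooth_on S g"
  unfolding smooth_on_def using Ck_on_cong[of S f g] by auto

lemma smooth_on_local:
  "(\<And>x. x \<in> S \<Longrightarrow> \<exists>U. open U \<and> x \<in> U \<and> smooth_on U f) \<Longrightarrow> smooth_on S f"
  unfolding smooth_on_def by (meson Ck_on_local)

lemma smooth_on_const: "smooth_on S (\<lambda>x. c)"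
  by (simp add: smooth_on_def Ck_on_const)

lemma smooth_on_linear: "bounded_linear L \<Longrightarrow> smooth_on S L"
  by (simp add: smooth_on_def Ck_on_linear)

lemma smooth_on_add: "open S \<Longrightarrow> smooth_on S f \<Longrightarrow> smooth_on S g \<Longrightarrow> smooth_on S (\<lambda>x. f x + g x)"
  by (simp add: smooth_on_def Ck_on_add)

lemma smooth_on_sum: "open S \<Longrightarrow> (\<And>i. i \<in> I \<Longrightarrow> smooth_on S (f i)) \<Longrightarrow> smooth_on S (\<lambda>x. \<Sum>i\<in>I. f i x)"
  by (simp add: smooth_on_def Ck_on_sum)

lemma smooth_on_bilinear:
  "bounded_bilinear B \<Longrightarrow> open S \<Longrightarrow> smooth_on S f \<Longrightarrow> smooth_on S g \<Longrightarrow> smooth_on S (\<lambda>x. B (f x) (g x))"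
  by (simp add: smooth_on_def Ck_on_bilinear)

lemma smooth_on_compose:
  fixes f :: "'a::real_normed_vector \<Rightarrow> 'b::euclidean_space"
  shows "open S \<Longrightarrow> smooth_on S f \<Longrightarrow> smooth_on T g \<Longrightarrow> f ` S \<subseteq> T \<Longrightarrow> smooth_on S (\<lambda>x. g (f x))"
  unfolding smooth_on_def using Ck_on_compose[of S _ f T g] by auto

lemma smooth_on_continuous: "smooth_on S f \<Longrightarrow> continuous_on S f"
  unfolding smooth_on_def by (metis Ck_on.simps(1))

lemma smooth_on_has_derivative:
  "smooth_on S f \<Longrightarrow> x \<in> S \<Longrightarrow> (f has_derivative frechet_derivative f (at x)) (at x)"
  unfolding smooth_on_def using Ck_on_SucD(1) by blast

lemma smooth_on_frechet_derivative:
  "smooth_on S f \<Longrightarrow> smooth_on S (\<lambda>x. frechet_derivative f (at x) v)"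
  unfolding smooth_on_def using Ck_on_SucD(2) by blast

text \<open>The derivative is a multiple of the square of \<open>inverse\<close> itself, so the
  induction on the order closes.\<close>

lemma smooth_on_inverse: "smooth_on {0<..} (inverse :: real \<Rightarrow> real)"
  unfolding smooth_on_def
proof
  fix k show "Ck_on k {0<..} (inverse :: real \<Rightarrow> real)"
  proof (induction k)
    case 0
    then show ?case by (auto intro!: continuous_intros)
  next
    case (Suc k)
    show ?case
    proof (rule Ck_on_SucI)
      show "(inverse has_derivative (\<lambda>v. (inverse x * inverse x) * - v)) (at x)"
        if "x \<in> {0<..}" for x :: real
        using that by (auto intro!: derivative_eq_intros)
      show "Ck_on k {0<..} (\<lambda>x::real. (inverse x * inverse x) * - v)" for v
        by (intro Ck_on_bilinear[OF bounded_bilinear_mult] Suc.IH Ck_on_const) auto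
    qed auto
  qed
qed

section \<open>Flat functions and a smooth radial cutoff\<close>

definition flat :: "real poly \<Rightarrow> real \<Rightarrow> real" where
  "flat p t = (if t \<le> 0 then 0 else poly p (1 / t) * exp (- (1 / t)))"

lemma poly_times_exp_tendsto_0: "((\<lambda>s::real. poly p s * exp (- s)) \<longlongrightarrow> 0) at_top"
proof -
  have "((\<lambda>s::real. \<Sum>i\<le>degree p. poly.coeff p i * (s ^ i / exp s)) \<longlongrightarrow> (\<Sum>i\<le>degree p. poly.coeff p i * 0)) at_top"
    by (intro tendsto_intros tendsto_power_div_exp_0)
  then show ?thesis
    by (simp add: poly_altdef sum_distrib_right exp_minus divide_inverse mult.assoc)
qed

lemma flat_tendsto_0: "(flat p \<longlongrightarrow> 0) (at 0)"
proof (rule filterlim_split_at)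
  show "(flat p \<longlongrightarrow> 0) (at_left 0)"
    by (rule tendsto_eventually) (auto simp: flat_def eventually_at_filter)
  have "((\<lambda>t. poly p (1 / t) * exp (- (1 / t))) \<longlongrightarrow> 0) (at_right 0)"
    using filterlim_compose[OF poly_times_exp_tendsto_0 filterlim_inverse_at_top_right]
    by (simp add: field_simps)
  then show "(flat p \<longlongrightarrow> 0) (at_right 0)"
    by (rule Lim_transform_eventually) (auto simp: flat_def eventually_at_filter)
qed

text \<open>With s = 1/t one has ds/dt = -s^2, so p(s) exp(-s) differentiates to s^2 (p - p')(s)
  exp(-s). The family is closed under differentiation; this is why \<open>flat\<close> carries a
  polynomial, and smoothness follows for all members at once.\<close>

lemma DERIV_flat: "(flat p has_real_derivative flat ([:0, 0, 1:] * (p - pderiv p)) t) (at t)"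
proof -
  let ?q = "[:0, 0, 1:] * (p - pderiv p)"
  consider "t < 0" | "t = 0" | "t > 0" by linarith
  then show ?thesis
  proof cases
    case 1
    have "((\<lambda>t. 0) has_real_derivative flat ?q t) (at t)"
      using 1 by (simp add: flat_def)
    then show ?thesis
      by (rule has_field_derivative_transform_within_open[of _ _ _ "{..<0}"]) (use 1 in \<open>auto simp: flat_def\<close>)
  next
    case 2
    \<comment> \<open>Dividing by \<open>h\<close> gives the polynomial one more factor X, so the
      difference quotient is again flat, namely \<open>flat (pCons 0 p)\<close>.\<close>
    have "((\<lambda>h. (flat p (0 + h) - flat p 0) / h) \<longlongrightarrow> 0) (at 0)"
      by (rule Lim_transform_eventually[OF flat_tendsto_0[of "pCons 0 p"]])
         (auto simp: flat_def eventually_at_filter)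
    then show ?thesis
      using 2 by (simp add: has_field_derivative_iff flat_def)
  next
    case 3
    have "((\<lambda>t. poly p (1 / t) * exp (- (1 / t))) has_real_derivative flat ?q t) (at t)"
      using 3 by (auto intro!: derivative_eq_intros poly_DERIV[THEN DERIV_chain2]
          simp: flat_def power2_eq_square field_simps)
    then show ?thesis
      by (rule has_field_derivative_transform_within_open[of _ _ _ "{0<..}"]) (use 3 in \<open>auto simp: flat_def\<close>)
  qed
qed

lemma smooth_on_flat: "smooth_on UNIV (flat p)"
  unfolding smooth_on_def
proof
  fix k show "Ck_on k UNIV (flat p)"
  proof (induction k arbitrary: p)
    case 0
    then show ?case
      by (auto intro: continuous_at_imp_continuous_on DERIV_isCont DERIV_flat)
  next
    case (Suc k)
    show ?case
      by (rule Ck_on_SucI[OF _ DERIV_flat[unfolded has_field_derivative_def]])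
         (auto intro!: Ck_on_bilinear[OF bounded_bilinear_mult] Ck_on_const Suc.IH)
  qed
qed

text \<open>The usual quotient of one-sided flat functions, taken in the squared norm so that it is
  smooth at the origin too. The numbers 1/4 and 1 are the squares of the radii 1/2 and 1 between
  which the values pass from 1 to 0.\<close>

definition cutoff :: "'a::euclidean_space \<Rightarrow> real" where
  "cutoff y = flat 1 (1 - y \<bullet> y) * inverse (flat 1 (1 - y \<bullet> y) + flat 1 (y \<bullet> y - 1/4))"

lemma flat_1_pos: "t > 0 \<Longrightarrow> flat 1 t > 0" and flat_1_nonpos: "t \<le> 0 \<Longrightarrow> flat 1 t = 0"
  and flat_1_nonneg: "flat 1 t \<ge> 0"
  by (auto simp: flat_def)

lemma cutoff_denominator_pos: "flat 1 (1 - t) + flat 1 (t - 1/4) > 0"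
  using flat_1_pos[of "1 - t"] flat_1_pos[of "t - 1/4"] flat_1_nonneg[of "1 - t"] flat_1_nonneg[of "t - 1/4"]
  by (cases "t < 1") auto

lemma cutoff_bounds: "0 \<le> cutoff y" "cutoff y \<le> 1"
  using cutoff_denominator_pos[of "y \<bullet> y"] flat_1_nonneg
  by (auto simp: cutoff_def field_simps)

lemma cutoff_eq_1: "norm y \<le> 1/2 \<Longrightarrow> cutoff y = 1"
proof -
  assume "norm y \<le> 1/2"
  then have "y \<bullet> y \<le> 1/4"
    using power_mono[of "norm y" "1/2" 2] by (simp add: power2_norm_eq_inner power2_eq_square[of "1/2"])
  then show ?thesis
    using flat_1_pos[of "1 - y \<bullet> y"] flat_1_nonpos[of "y \<bullet> y - 1/4"] by (simp add: cutoff_def)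
qed

lemma cutoff_eq_0: "norm y \<ge> 1 \<Longrightarrow> cutoff y = 0"
proof -
  assume "norm y \<ge> 1"
  then have "y \<bullet> y \<ge> 1"
    using power_mono[of 1 "norm y" 2] by (simp add: power2_norm_eq_inner)
  then show ?thesis
    using flat_1_nonpos[of "1 - y \<bullet> y"] by (simp add: cutoff_def)
qed

lemma smooth_cutoff: "smooth_on UNIV (cutoff :: 'a::euclidean_space \<Rightarrow> real)"
proof -
  have sq: "smooth_on UNIV (\<lambda>y::'a. y \<bullet> y)"
    by (intro smooth_on_bilinear[OF bounded_bilinear_inner] smooth_on_linear bounded_linear_ident) auto
  have a: "smooth_on UNIV (\<lambda>y::'a. flat 1 (1 - y \<bullet> y))"
  proof (rule smooth_on_compose[where g = "flat 1" and T = UNIV])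
    have "smooth_on UNIV (\<lambda>y::'a. 1 + (- 1) * (y \<bullet> y))"
      by (intro smooth_on_add smooth_on_const smooth_on_bilinear[OF bounded_bilinear_mult] sq) auto
    then show "smooth_on UNIV (\<lambda>y::'a. 1 - y \<bullet> y)" by simp
  qed (auto simp: smooth_on_flat)
  have b: "smooth_on UNIV (\<lambda>y::'a. flat 1 (y \<bullet> y - 1/4))"
  proof (rule smooth_on_compose[where g = "flat 1" and T = UNIV])
    have "smooth_on UNIV (\<lambda>y::'a. y \<bullet> y + (- 1/4))"
      by (intro smooth_on_add smooth_on_const sq) auto
    then show "smooth_on UNIV (\<lambda>y::'a. y \<bullet> y - 1/4)" by simp
  qed (auto simp: smooth_on_flat)
  have "smooth_on UNIV (\<lambda>y::'a. inverse (flat 1 (1 - y \<bullet> y) + flat 1 (y \<bullet> y - 1/4)))"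
    by (rule smooth_on_compose[where g = inverse and T = "{0<..}"])
       (auto intro!: smooth_on_add a b smooth_on_inverse cutoff_denominator_pos)
  then show ?thesis
    unfolding cutoff_def[abs_def] by (intro smooth_on_bilinear[OF bounded_bilinear_mult] a) auto
qed

section \<open>Points have zero capacity in the plane\<close>

lemma square_sum_orthogonal:
  fixes a :: "'i \<Rightarrow> real"
  assumes "finite K" "\<And>j k. j \<in> K \<Longrightarrow> k \<in> K \<Longrightarrow> j \<noteq> k \<Longrightarrow> a j * a k = 0"
  shows "(\<Sum>k\<in>K. a k)\<^sup>2 = (\<Sum>k\<in>K. (a k)\<^sup>2)"
proof -
  have "(\<Sum>k\<in>K. a j * a k) = (a j)\<^sup>2" if "j \<in> K" for j
  proof -
    have "(\<Sum>k\<in>K. a j * a k) = (\<Sum>k\<in>K. if k = j then (a j)\<^sup>2 else 0)"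
      using assms(2) that by (intro sum.cong) (auto simp: power2_eq_square)
    then show ?thesis using assms(1) that by simp
  qed
  then show ?thesis
    by (simp add: power2_eq_square sum_product)
qed

text \<open>The balls of radius r/4^k have areas in the ratio 1/16; this bounds their sum uniformly
  in \<open>n\<close>.\<close>

lemma sum_inverse_16_le_2: "(\<Sum>k<n. (1 / 16 :: real) ^ k) \<le> 2"
proof -
  have "(\<Sum>k<n. (1 / 16 :: real) ^ k) = (1 - (1/16) ^ n) * (16/15)"
    by (subst sum_gp_strict) (auto simp: field_simps)
  also have "\<dots> \<le> 1 * (16 / 15)" by (intro mult_right_mono) auto
  also have "\<dots> \<le> 2" by simp
  finally show ?thesis .
qed

definition grad2 :: "(real^2 \<Rightarrow> real) \<Rightarrow> real^2 \<Rightarrow> real" where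
  "grad2 v x = (\<Sum>i\<in>UNIV. (partial v i x)\<^sup>2)"

lemma partial_locally_const:
  assumes "open U" "x \<in> U" "\<And>y. y \<in> U \<Longrightarrow> v y = c"
  shows "partial v i x = 0"
proof -
  have "(v has_derivative (\<lambda>_. 0)) (at x)"
    by (rule has_derivative_transform_within_open[OF has_derivative_const[of c] assms(1,2)]) (simp add: assms(3))
  then have "frechet_derivative v (at x) = (\<lambda>_. 0)"
    using frechet_derivative_at by metis
  then show ?thesis by (simp add: partial_def)
qed

text \<open>The strict inequalities leave an open neighbourhood on which the cutoff is
  constant.\<close>

lemma partial_cutoff_eq_0:
  assumes "norm y < 1/2 \<or> 1 < norm y"
  shows "partial cutoff i y = 0"
  using assms
proof
  assume "norm y < 1/2"
  then show ?thesis
    by (intro partial_locally_const[of "ball 0 (1/2)"]) (auto intro!: cutoff_eq_1 order_less_imp_le)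
next
  assume "norm y > 1"
  then show ?thesis
    by (intro partial_locally_const[of "- cball 0 1"]) (auto intro!: cutoff_eq_0)
qed

lemma continuous_on_grad2_cutoff: "continuous_on UNIV (grad2 cutoff)"
  unfolding grad2_def partial_def
  by (intro continuous_intros smooth_on_continuous smooth_on_frechet_derivative smooth_cutoff)

lemma grad2_cutoff_bound: obtains M where "M \<ge> 0" "\<And>y. grad2 cutoff y \<le> M"
proof -
  have "compact (grad2 cutoff ` cball 0 1)"
    by (intro compact_continuous_image continuous_on_subset[OF continuous_on_grad2_cutoff]) auto
  then obtain M where M: "grad2 cutoff y \<le> M" if "y \<in> cball 0 1" for y
    by (meson bdd_above.E bounded_imp_bdd_above compact_imp_bounded imageI)
  have "grad2 cutoff y \<le> max 0 M" for y
  proof (cases "norm y \<le> 1")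
    case True then show ?thesis using M[of y] by auto
  next
    case False then show ?thesis by (simp add: grad2_def partial_cutoff_eq_0)
  qed
  then show thesis using that[of "max 0 M"] by auto
qed

text \<open>
  The \<open>4\<^sup>k\<close>-fold rescalings of a fixed cutoff have disjointly supported gradients of equal \<open>L\<^sup>2\<close> norm,
  so the average of \<open>n\<close> of them has Dirichlet energy \<open>O(1/n)\<close>.
\<close>

lemma point_capacity_zero:
  fixes x0 :: "real^2"
  assumes r: "r > 0" and e: "e > 0"
  obtains s v where "s > 0" "smooth_on UNIV v" "\<And>x. 0 \<le> v x" "\<And>x. v x \<le> 1"
    "\<And>x. x \<notin> cball x0 r \<Longrightarrow> v x = 0" "\<And>x. x \<in> cball x0 s \<Longrightarrow> v x = 1"
    "(\<integral>\<^sup>+x. ennreal (grad2 v x + (v x)\<^sup>2) \<partial>lborel) \<le> ennreal e"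
proof -
  obtain M where M0: "M \<ge> 0" and M: "\<And>y. grad2 cutoff y \<le> M"
    using grad2_cutoff_bound by blast
  define V where "V = unit_ball_vol 2"
  have V: "V \<ge> 0" by (simp add: V_def)
  \<comment> \<open>Chosen for the final bound V (M + 2 r^2) / n: the \<open>n\<close> gradients
    contribute V M / n^2 each, the values V r^2 / n times a geometric sum of at most 2.\<close>
  obtain n :: nat where n: "n > 0" "V * (M + 2 * r\<^sup>2) / e < n"
    by (metis max_less_iff_conj of_nat_0_less_iff reals_Archimedean2)
  define q where "q k = 4 ^ k / r" for k :: nat
  have q: "q k > 0" for k using r by (simp add: q_def)
  define Y where "Y k x = q k *\<^sub>R (x - x0)" for k x
  define v where "v x = (\<Sum>k<n. cutoff (Y k x)) / n" for x
  let ?B = "\<lambda>k. cball x0 (r / 4 ^ k)"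
  have norm_Y: "norm (Y k x) = q k * dist x0 x" for k x
    using q[of k] by (simp add: Y_def dist_norm norm_minus_commute)
  have inB: "x \<in> ?B k \<longleftrightarrow> norm (Y k x) \<le> 1" for k x
    using r by (simp add: norm_Y q_def field_simps)
  have aff: "smooth_on UNIV (\<lambda>x. Y k x)" for k
  proof -
    have "smooth_on UNIV (\<lambda>x. q k *\<^sub>R x + q k *\<^sub>R (- x0))"
      by (intro smooth_on_add smooth_on_linear smooth_on_const bounded_linear_scaleR_right) auto
    then show ?thesis by (simp add: Y_def[abs_def] scaleR_diff_right)
  qed
  have smooth: "smooth_on UNIV v"
  proof -
    have "smooth_on UNIV (\<lambda>x. (\<Sum>k<n. cutoff (Y k x)) * (1 / n))"
      by (intro smooth_on_bilinear[OF bounded_bilinear_mult] smooth_on_sum smooth_on_const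
          smooth_on_compose[OF _ aff smooth_cutoff]) auto
    then show ?thesis by (simp add: v_def[abs_def])
  qed
  have cut_le: "cutoff (Y k x) \<le> indicator (?B k) x" for k x
    using cutoff_bounds(2)[of "Y k x"] cutoff_eq_0[of "Y k x"] inB[of x k]
    by (auto simp: indicator_def)
  have v0: "0 \<le> v x" for x
    by (simp add: v_def sum_nonneg cutoff_bounds)
  have v1: "v x \<le> 1" for x
    using sum_mono[of "{..<n}" "\<lambda>k. cutoff (Y k x)" "\<lambda>_. 1"] n(1)
    by (simp add: v_def cutoff_bounds field_simps)
  have out: "v x = 0" if "x \<notin> cball x0 r" for x
  proof -
    have "norm (Y k x) \<ge> 1" for k
    proof -
      have "dist x0 x \<ge> r" "(1::real) \<le> 4 ^ k" using that by auto
      then have "r * 1 \<le> dist x0 x * 4 ^ k" using r by (intro mult_mono) auto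
      then show ?thesis using r by (simp add: norm_Y q_def field_simps)
    qed
    then show ?thesis by (simp add: v_def cutoff_eq_0)
  qed
  \<comment> \<open>Half the radius of the ball at scale \<open>n\<close>, one scale beyond the last
    cutoff, so all \<open>n\<close> cutoffs equal 1 there.\<close>
  define s where "s = r / 4 ^ n / 2"
  have s: "s > 0" using r by (simp add: s_def)
  have ins: "v x = 1" if "x \<in> cball x0 s" for x
  proof -
    have "norm (Y k x) \<le> 1/2" if "k < n" for k
    proof -
      have "(4::real) ^ k \<le> 4 ^ n" using that by (intro power_increasing) auto
      then have "4 ^ k * dist x0 x \<le> 4 ^ n * s"
        using \<open>x \<in> cball x0 s\<close> s by (intro mult_mono) auto
      also have "\<dots> = r / 2" by (simp add: s_def)
      finally show ?thesis using r by (simp add: norm_Y q_def field_simps)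
    qed
    then show ?thesis using n(1) by (simp add: v_def cutoff_eq_1)
  qed
  have part: "partial v i x = (\<Sum>k<n. q k * partial cutoff i (Y k x)) / n" for i x
  proof -
    have "((\<lambda>x. cutoff (Y k x)) has_derivative (\<lambda>h. frechet_derivative cutoff (at (Y k x)) (q k *\<^sub>R h))) (at x)" for k
    proof -
      have "(Y k has_derivative (\<lambda>h. q k *\<^sub>R h)) (at x)"
        unfolding Y_def[abs_def] by (auto intro!: derivative_eq_intros)
      from diff_chain_at[OF this smooth_on_has_derivative[OF smooth_cutoff UNIV_I]] show ?thesis
        by (simp add: o_def)
    qed
    then have "(v has_derivative (\<lambda>h. (\<Sum>k<n. frechet_derivative cutoff (at (Y k x)) (q k *\<^sub>R h)) / n)) (at x)"
      unfolding v_def[abs_def] divide_inverse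
      by (intro has_derivative_mult_left has_derivative_sum) auto
    moreover have "frechet_derivative cutoff (at y) (a *\<^sub>R h) = a * frechet_derivative cutoff (at y) h"
      for y h :: "real^2" and a
      using linear_scale[OF has_derivative_linear[OF smooth_on_has_derivative[OF smooth_cutoff UNIV_I]]] by auto
    ultimately show ?thesis
      unfolding partial_def by (simp add: frechet_derivative_at[symmetric])
  qed
  \<comment> \<open>The k-th gradient lives in the annulus between r/(2 4^k) and r/4^k. With ratio 2
    in place of 4 consecutive closed annuli would touch; with 4 they are disjoint.\<close>
  have disj: "partial cutoff i (Y j x) * partial cutoff i (Y k x) = 0" if "j \<noteq> k" for i j k x
  proof (rule ccontr)
    assume "\<not> ?thesis"
    then have a: "1/2 \<le> norm (Y j x)" "norm (Y j x) \<le> 1" "1/2 \<le> norm (Y k x)" "norm (Y k x) \<le> 1"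
      using partial_cutoff_eq_0 by (metis mult_eq_0_iff not_le)+
    have *: False if "j < k" "1/2 \<le> norm (Y j x)" "norm (Y k x) \<le> 1" for j k
    proof -
      have "(4::real) ^ Suc j \<le> 4 ^ k" using that by (intro power_increasing) auto
      then have "4 ^ Suc j * dist x0 x \<le> 4 ^ k * dist x0 x" by (intro mult_right_mono) auto
      moreover have "4 ^ k * dist x0 x \<le> r" "r \<le> 2 * (4 ^ j * dist x0 x)"
        using that r by (simp_all add: norm_Y q_def field_simps)
      ultimately show False using r by simp
    qed
    show False using *[of j k] *[of k j] a that by linarith
  qed
  \<comment> \<open>The first summand bounds the squared gradient at scale \<open>k\<close>, where
    rescaling produces the factor \<open>q k\<close> squared; the second bounds the share of scale
    \<open>k\<close> in the square of \<open>v\<close>.\<close>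
  define C where "C k = M * 16 ^ k / (r\<^sup>2 * (real n)\<^sup>2) + 1 / n" for k :: nat
  have C0: "C k \<ge> 0" for k using M0 by (simp add: C_def)
  have grad: "grad2 v x \<le> (\<Sum>k<n. (M * 16 ^ k / (r\<^sup>2 * (real n)\<^sup>2)) * indicator (?B k) x)" for x
  proof -
    have "(\<Sum>k<n. q k * partial cutoff i (Y k x))\<^sup>2 = (\<Sum>k<n. (q k * partial cutoff i (Y k x))\<^sup>2)" for i
      by (rule square_sum_orthogonal) (use disj in \<open>auto simp: mult_ac\<close>)
    then have "grad2 v x = (\<Sum>i\<in>UNIV. (\<Sum>k<n. (q k * partial cutoff i (Y k x))\<^sup>2) / (real n)\<^sup>2)"
      by (simp add: grad2_def part power_divide)
    also have "\<dots> = (\<Sum>k<n. (q k)\<^sup>2 / (real n)\<^sup>2 * grad2 cutoff (Y k x))"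
      unfolding grad2_def sum_divide_distrib sum_distrib_left
      by (subst sum.swap) (simp add: power_mult_distrib)
    also have "\<dots> \<le> (\<Sum>k<n. (q k)\<^sup>2 / (real n)\<^sup>2 * (M * indicator (?B k) x))"
    proof (intro sum_mono mult_left_mono)
      fix k
      show "grad2 cutoff (Y k x) \<le> M * indicator (?B k) x"
      proof (cases "x \<in> ?B k")
        case True then show ?thesis using M by simp
      next
        case False
        then show ?thesis using inB[of x k] by (simp add: grad2_def partial_cutoff_eq_0)
      qed
    qed simp
    also have "\<dots> = (\<Sum>k<n. (M * 16 ^ k / (r\<^sup>2 * (real n)\<^sup>2)) * indicator (?B k) x)"
      by (intro sum.cong) (auto simp: q_def power_divide power2_eq_square power_mult_distrib[symmetric])
    finally show ?thesis .
  qed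
  \<comment> \<open>Since 0 \<le> v \<le> 1, the square is at most \<open>v\<close>, which is linear
    in the cutoffs and so produces no cross terms.\<close>
  have sq: "(v x)\<^sup>2 \<le> (\<Sum>k<n. 1 / n * indicator (?B k) x)" for x
  proof -
    have "(v x)\<^sup>2 \<le> v x" using v0[of x] v1[of x] by (simp add: power2_eq_square mult_left_le)
    also have "\<dots> = (\<Sum>k<n. 1 / n * cutoff (Y k x))" by (simp add: v_def sum_divide_distrib)
    also have "\<dots> \<le> (\<Sum>k<n. 1 / n * indicator (?B k) x)"
      by (intro sum_mono mult_left_mono cut_le) auto
    finally show ?thesis .
  qed
  have le: "grad2 v x + (v x)\<^sup>2 \<le> (\<Sum>k<n. C k * indicator (?B k) x)" for x
    using grad[of x] sq[of x] by (simp add: C_def distrib_right sum.distrib)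
  have "(\<integral>\<^sup>+x. ennreal (grad2 v x + (v x)\<^sup>2) \<partial>lborel) \<le> (\<integral>\<^sup>+x. (\<Sum>k<n. ennreal (C k) * indicator (?B k) x) \<partial>lborel)"
  proof (rule nn_integral_mono)
    fix x
    have "(\<Sum>k<n. ennreal (C k) * indicator (?B k) x) = ennreal (\<Sum>k<n. C k * indicator (?B k) x)"
      using C0 by (subst sum_ennreal[symmetric]) (auto simp: ennreal_mult ennreal_indicator intro!: sum.cong)
    then show "ennreal (grad2 v x + (v x)\<^sup>2) \<le> (\<Sum>k<n. ennreal (C k) * indicator (?B k) x)"
      using le[of x] by (simp add: ennreal_leI)
  qed
  also have "\<dots> = (\<Sum>k<n. ennreal (C k) * emeasure lborel (?B k))"
    by (subst nn_integral_sum) (auto simp: nn_integral_cmult_indicator intro!: borel_measurable_times_ennreal borel_measurable_indicator)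
  also have "\<dots> = (\<Sum>k<n. ennreal (C k * (V * (r / 4 ^ k)\<^sup>2)))"
    using r C0 V by (intro sum.cong) (auto simp: emeasure_cball V_def ennreal_mult)
  also have "\<dots> = ennreal (\<Sum>k<n. C k * (V * (r / 4 ^ k)\<^sup>2))"
    using C0 V by (intro sum_ennreal) auto
  also have "\<dots> \<le> ennreal e"
  proof (rule ennreal_leI)
    \<comment> \<open>The 16^k from the gradient cancels the 16^-k from the area: Dirichlet energy
      is scale invariant in the plane, so every scale costs the same V M / n^2.\<close>
    have "C k * (V * (r / 4 ^ k)\<^sup>2) = V * M / (real n)\<^sup>2 + V * r\<^sup>2 / n * (1/16) ^ k" for k
    proof -
      have *: "(4 ^ k)\<^sup>2 = (16 ^ k :: real)" by (simp add: power2_eq_square power_mult_distrib[symmetric])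
      show ?thesis
        using r n(1) by (simp add: C_def power_divide * field_simps)
    qed
    then have "(\<Sum>k<n. C k * (V * (r / 4 ^ k)\<^sup>2)) = V * M / n + V * r\<^sup>2 / n * (\<Sum>k<n. (1/16) ^ k)"
      using n(1) by (simp only: sum.distrib sum_distrib_left[symmetric]) (simp add: power2_eq_square)
    also have "\<dots> \<le> V * M / n + V * r\<^sup>2 / n * 2"
      using V by (intro add_left_mono mult_left_mono sum_inverse_16_le_2) auto
    also have "\<dots> = V * (M + 2 * r\<^sup>2) / n" by (simp add: add_divide_distrib[symmetric] algebra_simps)
    also have "\<dots> \<le> e" using n e by (simp add: field_simps)
    finally show "(\<Sum>k<n. C k * (V * (r / 4 ^ k)\<^sup>2)) \<le> e" .
  qed
  finally show thesis
    using that[of s v] s smooth v0 v1 out ins by blast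
qed

section \<open>Compact surfaces\<close>

locale compact_surface =
  fixes X :: "'a topology" and \<A> :: "'a chart set"
  assumes surface: "smooth_surface X \<A>" and compact: "compact_space X"
begin

lemma Hausdorff: "Hausdorff_space X"
  and charts_cover: "topspace X \<subseteq> (\<Union>c\<in>\<A>. chart_dom c)"
  using surface by (auto simp: smooth_surface_def smooth_structure_def smooth_atlas_def)

context
  fixes c assumes c: "c \<in> \<A>"
begin

lemma is_chart: "is_chart X c"
  using surface c by (simp add: smooth_surface_def smooth_structure_def smooth_atlas_def)

lemma openin_chart_dom: "openin X (chart_dom c)" and open_chart_img: "open (chart_img c)"
  and homeomorphic_chart_map:
    "homeomorphic_map (subtopology X (chart_dom c)) (top_of_set (chart_img c)) (chart_map c)"
  using is_chart by (auto simp: is_chart_def)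

lemma chart_dom_subset: "chart_dom c \<subseteq> topspace X"
  using openin_chart_dom openin_subset by blast

lemma topspace_chart_dom: "topspace (subtopology X (chart_dom c)) = chart_dom c"
  using chart_dom_subset by auto

lemma inj_chart_map: "inj_on (chart_map c) (chart_dom c)"
  using homeomorphic_imp_injective_map[OF homeomorphic_chart_map] topspace_chart_dom by simp

lemma chart_inv_chart_map [simp]: "p \<in> chart_dom c \<Longrightarrow> chart_inv c (chart_map c p) = p"
  by (simp add: chart_inv_def inj_chart_map)

end

lemma chart_inv_in_dom: "x \<in> chart_img c \<Longrightarrow> chart_inv c x \<in> chart_dom c"
  by (simp add: chart_inv_def chart_img_def inv_into_into)

lemma chart_map_chart_inv [simp]: "x \<in> chart_img c \<Longrightarrow> chart_map c (chart_inv c x) = x"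
  by (simp add: chart_inv_def chart_img_def f_inv_into_f)

lemma chart_map_in_img: "p \<in> chart_dom c \<Longrightarrow> chart_map c p \<in> chart_img c"
  by (simp add: chart_img_def)

lemma chart_map_image_eq:
  assumes "c \<in> \<A>"
  shows "chart_map c ` (chart_dom c \<inter> B) = {x \<in> chart_img c. chart_inv c x \<in> B}"
proof safe
  fix x assume "x \<in> chart_img c" "chart_inv c x \<in> B"
  then show "x \<in> chart_map c ` (chart_dom c \<inter> B)"
    using chart_inv_in_dom[of x c] by (intro image_eqI[of _ _ "chart_inv c x"]) auto
qed (use assms in \<open>auto simp: chart_map_in_img\<close>)

lemma open_chart_image:
  assumes c: "c \<in> \<A>" and U: "openin X U"
  shows "open (chart_map c ` (chart_dom c \<inter> U))"
proof -
  have "openin (subtopology X (chart_dom c)) (chart_dom c \<inter> U)"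
    using U by (auto simp: openin_subtopology)
  then have "openin (top_of_set (chart_img c)) (chart_map c ` (chart_dom c \<inter> U))"
    using homeomorphic_imp_open_map[OF homeomorphic_chart_map[OF c]] by (simp add: open_map_def)
  then show ?thesis using open_chart_img[OF c] openin_open_trans by blast
qed

lemma open_chart_preimage:
  assumes c: "c \<in> \<A>" and W: "open W"
  shows "openin X {p \<in> chart_dom c. chart_map c p \<in> W}"
proof -
  have "continuous_map (subtopology X (chart_dom c)) euclidean (chart_map c)"
    using homeomorphic_imp_continuous_map[OF homeomorphic_chart_map[OF c]]
    by (simp add: continuous_map_in_subtopology)
  then have "openin (subtopology X (chart_dom c)) {p \<in> chart_dom c. chart_map c p \<in> W}"
    using openin_continuous_map_preimage[of "subtopology X (chart_dom c)" euclidean "chart_map c" W] W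
    by (simp add: topspace_chart_dom[OF c] del: topspace_subtopology)
  then show ?thesis using openin_chart_dom[OF c] openin_trans_full by blast
qed

lemma continuous_chart_inv:
  assumes c: "c \<in> \<A>"
  shows "continuous_map (top_of_set (chart_img c)) X (chart_inv c)"
  unfolding continuous_map_def
proof (intro conjI allI impI)
  show "chart_inv c \<in> topspace (top_of_set (chart_img c)) \<rightarrow> topspace X"
    using chart_inv_in_dom[of _ c] chart_dom_subset[OF c] by auto
  fix U assume "openin X U"
  then have "open {x \<in> chart_img c. chart_inv c x \<in> U}"
    using open_chart_image[OF c] chart_map_image_eq[OF c] by metis
  then show "openin (top_of_set (chart_img c)) {x \<in> topspace (top_of_set (chart_img c)). chart_inv c x \<in> U}"
    by (auto intro!: open_openin_trans[OF open_chart_img[OF c]])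
qed

text \<open>The image is compact, and compact sets are closed in a Hausdorff space. The complement
  is thus an open set on which a function supported in \<open>K\<close> vanishes.\<close>

lemma closedin_chart_inv_image:
  assumes c: "c \<in> \<A>" and K: "compact K" "K \<subseteq> chart_img c"
  shows "closedin X (chart_inv c ` K)"
proof -
  have "compactin (top_of_set (chart_img c)) K"
    using K by (simp add: compactin_subtopology)
  then have "compactin X (chart_inv c ` K)"
    using continuous_chart_inv[OF c] image_compactin by blast
  then show ?thesis using Hausdorff compactin_imp_closedin by blast
qed

lemma in_overlap_iff:
  assumes c: "c \<in> \<A>"
  shows "x \<in> overlap c d \<longleftrightarrow> x \<in> chart_img c \<and> chart_inv c x \<in> chart_dom d"
  unfolding overlap_def by (simp add: chart_map_image_eq[OF c])

lemma open_overlap: "c \<in> \<A> \<Longrightarrow> d \<in> \<A> \<Longrightarrow> open (overlap c d)"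
  unfolding overlap_def by (intro open_chart_image openin_chart_dom)

lemma smooth_transition:
  assumes "c \<in> \<A>" "d \<in> \<A>"
  shows "smooth_on (overlap c d) (transition c d)"
  using assms surface
  by (simp add: smooth_surface_def smooth_structure_def smooth_atlas_def compatible_def)

lemma transition_in_overlap:
  assumes "c \<in> \<A>" "d \<in> \<A>" "x \<in> overlap c d"
  shows "transition c d x \<in> overlap d c"
  using assms by (auto simp: in_overlap_iff transition_def chart_map_in_img chart_inv_in_dom)

lemma chart_inv_transition:
  assumes "c \<in> \<A>" "d \<in> \<A>" "x \<in> overlap c d"
  shows "chart_inv d (transition c d x) = chart_inv c x"
  using assms by (auto simp: in_overlap_iff transition_def)

section \<open>Extension by zero from a chart to the surface\<close>

definition zero_ext :: "'a chart \<Rightarrow> (real^2 \<Rightarrow> 'b::real_normed_vector) \<Rightarrow> 'a \<Rightarrow> 'b" where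
  "zero_ext c v p = (if p \<in> chart_dom c then v (chart_map c p) else 0)"

lemma zero_ext_chart_inv: "x \<in> chart_img c \<Longrightarrow> zero_ext c v (chart_inv c x) = v x"
  by (simp add: zero_ext_def chart_inv_in_dom)

lemma zero_ext_eq_0:
  assumes "c \<in> \<A>" "p \<notin> chart_inv c ` K" "\<And>x. x \<notin> K \<Longrightarrow> v x = 0"
  shows "zero_ext c v p = 0"
  using assms(2) chart_inv_chart_map[OF assms(1)] assms(3)[of "chart_map c p"]
  by (metis zero_ext_def image_eqI)

text \<open>Near a point of the domain of \<open>c\<close> the function is \<open>v\<close> composed
  with a smooth transition map. Any other point lies in the complement of the image of
  \<open>K\<close>, which is open and on which the function is 0.\<close>

lemma smooth_zero_ext:
  assumes c: "c \<in> \<A>" and K: "compact K" "K \<subseteq> chart_img c"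
    and v: "smooth_on UNIV v" "\<And>x. x \<notin> K \<Longrightarrow> v x = 0"
  shows "smooth_fun \<A> (zero_ext c v)"
  unfolding smooth_fun_def
proof
  fix d assume d: "d \<in> \<A>"
  let ?u = "zero_ext c v"
  show "smooth_on (chart_img d) (?u \<circ> chart_inv d)"
  proof (rule smooth_on_local)
    fix x assume x: "x \<in> chart_img d"
    show "\<exists>U. open U \<and> x \<in> U \<and> smooth_on U (?u \<circ> chart_inv d)"
    proof (cases "chart_inv d x \<in> chart_dom c")
      case True
      have "smooth_on (overlap d c) (\<lambda>y. v (transition d c y))"
        by (intro smooth_on_compose[OF open_overlap[OF d c] smooth_transition[OF d c] v(1)]) auto
      then have "smooth_on (overlap d c) (?u \<circ> chart_inv d)"
        by (rule smooth_on_cong[OF open_overlap[OF d c], rotated])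
           (auto simp: in_overlap_iff[OF d] zero_ext_def transition_def)
      then show ?thesis using open_overlap[OF d c] in_overlap_iff[OF d] x True by blast
    next
      case False
      let ?V = "chart_map d ` (chart_dom d \<inter> (topspace X - chart_inv c ` K))"
      have V: "open ?V"
        by (intro open_chart_image d openin_diff openin_topspace closedin_chart_inv_image c K)
      have "smooth_on ?V (\<lambda>_. 0 :: 'b)" by (rule smooth_on_const)
      then have "smooth_on ?V (?u \<circ> chart_inv d)"
        by (rule smooth_on_cong[OF V, rotated])
           (auto simp: chart_map_image_eq[OF d] zero_ext_eq_0[OF c _ v(2)])
      moreover have "x \<in> ?V"
      proof -
        have "chart_inv d x \<notin> chart_inv c ` K"
          using False K(2) chart_inv_in_dom[of _ c] by auto
        then show ?thesis
          using x chart_inv_in_dom[OF x] chart_dom_subset[OF d] by (auto simp: chart_map_image_eq[OF d])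
      qed
      ultimately show ?thesis using V by blast
    qed
  qed
qed

lemma smooth_fun_const: "smooth_fun \<A> (\<lambda>p. k)"
  by (simp add: smooth_fun_def o_def smooth_on_const)

lemma smooth_fun_add:
  assumes "smooth_fun \<A> f" "smooth_fun \<A> g"
  shows "smooth_fun \<A> (\<lambda>p. f p + g p)"
  using assms by (auto simp: smooth_fun_def o_def intro!: smooth_on_add open_chart_img)

text \<open>Carries continuity of coordinate expressions over to the abstract space
  \<open>X\<close>; measurability of smooth functions rests on it.\<close>

lemma openin_local:
  assumes "S \<subseteq> topspace X" "\<And>d. d \<in> \<A> \<Longrightarrow> openin X (chart_dom d \<inter> S)"
  shows "openin X S"
proof -
  have "S = (\<Union>d\<in>\<A>. chart_dom d \<inter> S)" using assms(1) charts_cover by auto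
  then show ?thesis using assms(2) by (metis (no_types, lifting) imageE openin_Union)
qed

lemma openin_smooth_preimage:
  fixes f :: "'a \<Rightarrow> 'b::real_normed_vector"
  assumes f: "smooth_fun \<A> f" and W: "open W"
  shows "openin X {p \<in> topspace X. f p \<in> W}"
proof (rule openin_local)
  fix d assume d: "d \<in> \<A>"
  have "continuous_on (chart_img d) (f \<circ> chart_inv d)"
    using f d unfolding smooth_fun_def by (blast intro: smooth_on_continuous)
  then have "open (chart_img d \<inter> (f \<circ> chart_inv d) -` W)"
    using W continuous_on_open_vimage[OF open_chart_img[OF d]] by (metis Int_commute)
  then have "openin X {p \<in> chart_dom d. chart_map d p \<in> chart_img d \<inter> (f \<circ> chart_inv d) -` W}"
    by (rule open_chart_preimage[OF d])
  also have "{p \<in> chart_dom d. chart_map d p \<in> chart_img d \<inter> (f \<circ> chart_inv d) -` W}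
      = chart_dom d \<inter> {p \<in> topspace X. f p \<in> W}"
    using chart_dom_subset[OF d] chart_inv_chart_map[OF d] by (auto simp: chart_map_in_img)
  finally show "openin X (chart_dom d \<inter> {p \<in> topspace X. f p \<in> W})" .
qed auto

end

section \<open>The volume measure\<close>

lemma nn_integral_infinite_if_not_integrable_on:
  fixes f :: "'a::euclidean_space \<Rightarrow> real"
  assumes "(\<lambda>x. f x * indicator S x) \<in> borel_measurable borel" "\<And>x. x \<in> S \<Longrightarrow> 0 \<le> f x"
    and "\<not> f integrable_on S"
  shows "(\<integral>\<^sup>+x\<in>S. ennreal (f x) \<partial>lborel) = \<infinity>"
proof (rule ccontr)
  assume "(\<integral>\<^sup>+x\<in>S. ennreal (f x) \<partial>lborel) \<noteq> \<infinity>"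
  moreover have "ennreal (f x) * indicator S x = ennreal (f x * indicator S x)" for x
    by (simp split: split_indicator)
  ultimately have "(\<lambda>x. f x * indicator S x) integrable_on UNIV"
    using assms by (intro nn_integral_integrable_on) (auto simp: less_top split: split_indicator)
  then have "(\<lambda>x. if x \<in> S then f x else 0) integrable_on UNIV"
    by (rule integrable_eq) auto
  then show False using assms(3) by (simp add: integrable_restrict_UNIV)
qed

text \<open>Change of variables is available for \<open>has_integral\<close>, whereas the volume is
  defined by nonnegative integrals. The two fit together because a nonnegative measurable function
  that is not integrable has nonnegative integral \<infinity>.\<close>

lemma nn_integral_eq_of_has_integral_iff:
  fixes f :: "'a::euclidean_space \<Rightarrow> real" and g :: "'b::euclidean_space \<Rightarrow> real"
  assumes f: "(\<lambda>x. f x * indicator S x) \<in> borel_measurable borel" "\<And>x. x \<in> S \<Longrightarrow> 0 \<le> f x"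
    and g: "(\<lambda>x. g x * indicator T x) \<in> borel_measurable borel" "\<And>x. x \<in> T \<Longrightarrow> 0 \<le> g x"
    and eq: "\<And>b. (f has_integral b) S \<longleftrightarrow> (g has_integral b) T"
  shows "(\<integral>\<^sup>+x\<in>S. ennreal (f x) \<partial>lborel) = (\<integral>\<^sup>+x\<in>T. ennreal (g x) \<partial>lborel)"
proof (cases "f integrable_on S")
  case True
  then obtain b where b: "(f has_integral b) S" by blast
  then have "(g has_integral b) T" using eq by simp
  with b show ?thesis
    using nn_integral_has_integral_lebesgue'[of S f b] nn_integral_has_integral_lebesgue'[of T g b] f(2) g(2)
    by simp
next
  case False
  then have "\<not> g integrable_on T" using eq by (auto simp: integrable_on_def)
  with False show ?thesis
    using nn_integral_infinite_if_not_integrable_on[of f S] nn_integral_infinite_if_not_integrable_on[of g T] f g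
    by simp
qed

definition posdef :: "real^2^2 \<Rightarrow> bool" where
  "posdef H \<longleftrightarrow> transpose H = H \<and> (\<forall>v. v \<noteq> 0 \<longrightarrow> v \<bullet> (H *v v) > 0)"

text \<open>Two test vectors suffice: (1, 0) gives the entry a > 0, and (-b, a) gives a times the
  determinant.\<close>

lemma det_pos_if_posdef:
  assumes "posdef H"
  shows "det H > 0"
proof -
  have sym: "H $ 2 $ 1 = H $ 1 $ 2"
  proof -
    have "transpose H $ 1 $ 2 = H $ 2 $ 1" by (simp add: transpose_def)
    then show ?thesis using assms by (simp add: posdef_def)
  qed
  have q: "v \<bullet> (H *v v) > 0" if "v \<noteq> 0" for v
    using assms that by (simp add: posdef_def)
  let ?a = "H $ 1 $ 1" and ?b = "H $ 1 $ 2" and ?c = "H $ 2 $ 2"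
  have "vector [1, 0] \<noteq> (0 :: real^2)" by (metis vector_2(1) zero_index zero_neq_one)
  moreover have "vector [1, 0] \<bullet> (H *v vector [1, 0]) = ?a"
    by (simp add: inner_vec_def matrix_vector_mult_def sum_2)
  ultimately have a: "?a > 0" using q by metis
  then have "vector [- ?b, ?a] \<noteq> (0 :: real^2)" by (metis vector_2(2) zero_index less_irrefl)
  moreover have "vector [- ?b, ?a] \<bullet> (H *v vector [- ?b, ?a]) = ?a * (?a * ?c - ?b * ?b)"
    by (simp add: inner_vec_def matrix_vector_mult_def sum_2 sym algebra_simps)
  ultimately have "?a * (?a * ?c - ?b * ?b) > 0" using q by metis
  then show ?thesis using a sym by (simp add: det_2 zero_less_mult_iff)
qed

context compact_surface
begin

definition surface_borel :: "'a measure" where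
  "surface_borel = sigma (topspace X) {U. openin X U}"

lemma space_surface_borel [simp]: "space surface_borel = topspace X"
  by (simp add: surface_borel_def space_measure_of_conv)

lemma sets_surface_borel: "sets surface_borel = sigma_sets (topspace X) {U. openin X U}"
  unfolding surface_borel_def by (rule sets_measure_of) (auto dest: openin_subset)

lemma openin_sets_surface_borel: "openin X U \<Longrightarrow> U \<in> sets surface_borel"
  by (simp add: sets_surface_borel)

lemma chart_dom_sets_surface_borel: "c \<in> \<A> \<Longrightarrow> chart_dom c \<in> sets surface_borel"
  by (simp add: openin_sets_surface_borel openin_chart_dom)

lemma measurable_smooth_fun:
  fixes f :: "'a \<Rightarrow> 'b::real_normed_vector"
  assumes "smooth_fun \<A> f"
  shows "f \<in> borel_measurable surface_borel"
proof (rule borel_measurableI)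
  fix W :: "'b set" assume "open W"
  then show "f -` W \<inter> space surface_borel \<in> sets surface_borel"
    using openin_sets_surface_borel[OF openin_smooth_preimage[OF assms \<open>open W\<close>]]
    by (simp add: vimage_def Int_def conj_commute)
qed

abbreviation chart_space :: "'a chart \<Rightarrow> (real^2) measure" where
  "chart_space c \<equiv> restrict_space lborel (chart_img c)"

lemma measurable_chart_inv:
  assumes c: "c \<in> \<A>"
  shows "chart_inv c \<in> measurable (chart_space c) surface_borel"
  unfolding surface_borel_def
proof (rule measurable_measure_of)
  show "chart_inv c \<in> space (chart_space c) \<rightarrow> topspace X"
    using chart_inv_in_dom[of _ c] chart_dom_subset[OF c] by (auto simp: space_restrict_space)
  fix U assume "U \<in> {U. openin X U}"
  then have "open {x \<in> chart_img c. chart_inv c x \<in> U}"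
    using open_chart_image[OF c, of U] chart_map_image_eq[OF c, of U] by simp
  then have "{x \<in> chart_img c. chart_inv c x \<in> U} \<in> sets lborel" by simp
  moreover have "chart_inv c -` U \<inter> space (chart_space c) = {x \<in> chart_img c. chart_inv c x \<in> U}"
    by (auto simp: space_restrict_space)
  ultimately show "chart_inv c -` U \<inter> space (chart_space c) \<in> sets (chart_space c)"
    using open_chart_img[OF c] by (subst sets_restrict_space_iff) auto
qed (use openin_subset in auto)

lemma chart_image_borel:
  assumes c: "c \<in> \<A>" and B: "B \<in> sets surface_borel"
  shows "chart_map c ` (chart_dom c \<inter> B) \<in> sets borel"
proof -
  have "chart_inv c -` B \<inter> space (chart_space c) \<in> sets (chart_space c)"
    by (rule measurable_sets[OF measurable_chart_inv[OF c] B])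
  moreover have "chart_inv c -` B \<inter> space (chart_space c) = chart_map c ` (chart_dom c \<inter> B)"
    by (auto simp: chart_map_image_eq[OF c] space_restrict_space)
  ultimately show ?thesis
    using open_chart_img[OF c] by (simp add: sets_restrict_space_iff)
qed

definition volume_density :: "'a metric_field \<Rightarrow> 'a chart \<Rightarrow> real^2 \<Rightarrow> real" where
  "volume_density h c x = sqrt (det (h c x))"

text \<open>The push-forward of sqrt(det h) dx: the candidate for the volume restricted to a single
  chart domain.\<close>

definition chart_measure :: "'a metric_field \<Rightarrow> 'a chart \<Rightarrow> 'a measure" where
  "chart_measure h c = distr (density (chart_space c) (\<lambda>x. ennreal (volume_density h c x))) surface_borel (chart_inv c)"

text \<open>The condition under the \<open>THE\<close> of \<open>volume_measure\<close>, named so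
  that existence and uniqueness can be treated separately.\<close>

definition volume_spec :: "'a metric_field \<Rightarrow> 'a measure \<Rightarrow> bool" where
  "volume_spec h \<mu> \<longleftrightarrow> space \<mu> = topspace X \<and>
     sets \<mu> = sigma_sets (topspace X) {U. openin X U} \<and>
     (\<forall>c\<in>\<A>. \<forall>B\<in>sets \<mu>. B \<subseteq> chart_dom c \<longrightarrow>
        emeasure \<mu> B = (\<integral>\<^sup>+x\<in>chart_map c ` B. ennreal (sqrt (det (h c x))) \<partial>lborel))"

lemma volume_measure_eq: "volume_measure X \<A> h = (THE \<mu>. volume_spec h \<mu>)"
  unfolding volume_measure_def volume_spec_def by simp

text \<open>The cover is indexed by natural numbers so that \<open>disjointed\<close> can turn it
  into a partition.\<close>

lemma finite_subcover:
  assumes "\<And>p. p \<in> topspace X \<Longrightarrow> \<exists>U. openin X U \<and> p \<in> U \<and> P U"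
  obtains n :: nat and U where "\<And>i. i < n \<Longrightarrow> openin X (U i)" "\<And>i. i < n \<Longrightarrow> P (U i)"
    "topspace X = (\<Union>i<n. U i)"
proof -
  let ?\<U> = "{U. openin X U \<and> P U}"
  have "\<exists>\<F>. finite \<F> \<and> \<F> \<subseteq> ?\<U> \<and> topspace X \<subseteq> \<Union>\<F>"
    using compact assms unfolding compact_space_def compactin_def
    by (elim conjE allE[of _ ?\<U>]) blast
  then obtain \<F> where F: "finite \<F>" "\<F> \<subseteq> ?\<U>" "topspace X \<subseteq> \<Union>\<F>" by blast
  have "\<exists>(n :: nat) U. \<F> = U ` {i. i < n}"
    using finite_imp_nat_seg_image_inj_on[OF F(1)] by metis
  then obtain n :: nat and U where U: "\<F> = U ` {i. i < n}"
    by (elim exE)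
  show thesis
  proof (rule that[of n U])
    show "topspace X = (\<Union>i<n. U i)"
    proof
      show "(\<Union>i<n. U i) \<subseteq> topspace X" using F(2) U openin_subset by blast
    qed (use F(3) U in auto)
  qed (use F U in auto)
qed

text \<open>Measures can be glued along a Borel partition subordinate to charts, so this does the
  work of a partition of unity.\<close>

lemma chart_partition:
  obtains n :: nat and c D where "\<And>i. i < n \<Longrightarrow> c i \<in> \<A>" "\<And>i. i < n \<Longrightarrow> D i \<in> sets surface_borel"
    "\<And>i. i < n \<Longrightarrow> D i \<subseteq> chart_dom (c i)" "disjoint_family_on D {..<n}" "topspace X = (\<Union>i<n. D i)"
proof -
  have "\<exists>U. openin X U \<and> p \<in> U \<and> (\<exists>c\<in>\<A>. U \<subseteq> chart_dom c)" if p: "p \<in> topspace X" for p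
  proof -
    obtain c where "c \<in> \<A>" "p \<in> chart_dom c" using p charts_cover by blast
    then show ?thesis by (intro exI[of _ "chart_dom c"]) (auto simp: openin_chart_dom)
  qed
  then obtain n :: nat and U where U: "\<And>i. i < n \<Longrightarrow> openin X (U i)"
      "\<And>i. i < n \<Longrightarrow> \<exists>c\<in>\<A>. U i \<subseteq> chart_dom c" "topspace X = (\<Union>i<n. U i)"
    using finite_subcover[of "\<lambda>U. \<exists>c\<in>\<A>. U \<subseteq> chart_dom c"] by metis
  then have "\<forall>i. \<exists>c. i < n \<longrightarrow> c \<in> \<A> \<and> U i \<subseteq> chart_dom c" by blast
  from choice[OF this] obtain c where "\<forall>i. i < n \<longrightarrow> c i \<in> \<A> \<and> U i \<subseteq> chart_dom (c i)"
    by (rule exE)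
  then have c: "\<And>i. i < n \<Longrightarrow> c i \<in> \<A>" "\<And>i. i < n \<Longrightarrow> U i \<subseteq> chart_dom (c i)" by auto
  show thesis
  proof (rule that[of n c "disjointed U"])
    fix i assume i: "i < n"
    have "U i - (\<Union>j<i. U j) \<in> sets surface_borel"
      using U(1) i by (intro sets.Diff sets.finite_UN) (auto intro: openin_sets_surface_borel)
    then show "disjointed U i \<in> sets surface_borel" by (simp add: disjointed_def atLeast0LessThan)
    show "disjointed U i \<subseteq> chart_dom (c i)"
      by (rule order_trans[OF disjointed_subset[of U i] c(2)[OF i]])
  next
    show "disjoint_family_on (disjointed U) {..<n}"
      by (rule disjoint_family_on_mono[OF subset_UNIV disjoint_family_disjointed])
    show "topspace X = (\<Union>i<n. disjointed U i)"
      using U(3) finite_UN_disjointed_eq[of U n] by (simp add: atLeast0LessThan)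
  qed (use c in auto)
qed

text \<open>The specification fixes the measure of sets inside one chart, and the partition cuts
  every Borel set into finitely many such pieces.\<close>

lemma volume_spec_unique:
  assumes "volume_spec h \<mu>" "volume_spec h \<nu>"
  shows "\<mu> = \<nu>"
proof -
  obtain n :: nat and c D where D: "\<And>i. i < n \<Longrightarrow> c i \<in> \<A>" "\<And>i. i < n \<Longrightarrow> D i \<in> sets surface_borel"
    "\<And>i. i < n \<Longrightarrow> D i \<subseteq> chart_dom (c i)" "disjoint_family_on D {..<n}" "topspace X = (\<Union>i<n. D i)"
    using chart_partition by metis
  have sum: "emeasure M B = (\<Sum>i<n. emeasure M (B \<inter> D i))" if "sets M = sets surface_borel" "B \<in> sets surface_borel" for M B
  proof -
    have "(\<Sum>i<n. emeasure M (B \<inter> D i)) = emeasure M (\<Union>i<n. B \<inter> D i)"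
      using D(2,4) that by (intro sum_emeasure) (auto simp: disjoint_family_on_def)
    also have "(\<Union>i<n. B \<inter> D i) = B"
      using D(5) sets.sets_into_space[OF that(2)] by auto
    finally show ?thesis by simp
  qed
  show ?thesis
  proof (rule measure_eqI)
    show "sets \<mu> = sets \<nu>" using assms by (simp add: volume_spec_def)
    fix B assume "B \<in> sets \<mu>"
    then have B: "B \<in> sets surface_borel" using assms by (simp add: volume_spec_def sets_surface_borel)
    have "emeasure \<mu> (B \<inter> D i) = emeasure \<nu> (B \<inter> D i)" if "i < n" for i
    proof -
      have "B \<inter> D i \<in> sets surface_borel" "B \<inter> D i \<subseteq> chart_dom (c i)"
        using B D(2,3)[OF that] by auto
      then show ?thesis
        using assms D(1)[OF that] by (simp add: volume_spec_def sets_surface_borel)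
    qed
    then show "emeasure \<mu> B = emeasure \<nu> B"
      using assms B by (subst (1 2) sum) (auto simp: volume_spec_def sets_surface_borel)
  qed
qed

end

section \<open>Existence of the volume measure, its finiteness and its conformal change\<close>

locale riemannian_surface = compact_surface +
  fixes h :: "'a metric_field"
  assumes metric: "riemannian_metric \<A> h"
begin

lemma smooth_metric: "c \<in> \<A> \<Longrightarrow> smooth_on (chart_img c) (h c)"
  and posdef_metric: "c \<in> \<A> \<Longrightarrow> x \<in> chart_img c \<Longrightarrow> posdef (h c x)"
  and metric_transform: "c \<in> \<A> \<Longrightarrow> d \<in> \<A> \<Longrightarrow> x \<in> overlap c d \<Longrightarrow>
      h c x = transpose (jacobian c d x) ** h d (transition c d x) ** jacobian c d x"
  using metric by (auto simp: riemannian_metric_def posdef_def)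

lemma volume_density_pos: "c \<in> \<A> \<Longrightarrow> x \<in> chart_img c \<Longrightarrow> volume_density h c x > 0"
  by (simp add: volume_density_def det_pos_if_posdef posdef_metric)

lemma continuous_volume_density: "c \<in> \<A> \<Longrightarrow> continuous_on (chart_img c) (volume_density h c)"
  unfolding volume_density_def[abs_def] det_2
  by (intro continuous_intros smooth_on_continuous smooth_metric)

lemma measurable_volume_density [measurable]:
  "c \<in> \<A> \<Longrightarrow> (\<lambda>x. ennreal (volume_density h c x)) \<in> borel_measurable (chart_space c)"
  using borel_measurable_continuous_on_restrict[OF continuous_volume_density, of c]
  by (intro measurable_compose[OF _ measurable_ennreal])
     (simp add: measurable_cong_sets[OF sets_restrict_space_cong[OF sets_lborel] refl])

lemma nn_integral_chart_measure:
  assumes c: "c \<in> \<A>" and F: "F \<in> borel_measurable surface_borel"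
  shows "(\<integral>\<^sup>+p. F p \<partial>chart_measure h c) =
    (\<integral>\<^sup>+x\<in>chart_img c. ennreal (volume_density h c x) * F (chart_inv c x) \<partial>lborel)"
proof -
  note [measurable] = measurable_chart_inv[OF c] F measurable_volume_density[OF c]
  have "(\<integral>\<^sup>+p. F p \<partial>chart_measure h c) =
      (\<integral>\<^sup>+x. F (chart_inv c x) \<partial>density (chart_space c) (\<lambda>x. ennreal (volume_density h c x)))"
    unfolding chart_measure_def by (rule nn_integral_distr) auto
  also have "\<dots> = (\<integral>\<^sup>+x. ennreal (volume_density h c x) * F (chart_inv c x) \<partial>chart_space c)"
    by (rule nn_integral_density) auto
  also have "\<dots> = (\<integral>\<^sup>+x\<in>chart_img c. ennreal (volume_density h c x) * F (chart_inv c x) \<partial>lborel)"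
    using open_chart_img[OF c] by (intro nn_integral_restrict_space) auto
  finally show ?thesis .
qed

lemma emeasure_chart_measure:
  assumes c: "c \<in> \<A>" and B: "B \<in> sets surface_borel"
  shows "emeasure (chart_measure h c) B =
    (\<integral>\<^sup>+x\<in>chart_map c ` (chart_dom c \<inter> B). ennreal (volume_density h c x) \<partial>lborel)"
proof -
  have "emeasure (chart_measure h c) B = (\<integral>\<^sup>+p. indicator B p \<partial>chart_measure h c)"
    using B by (simp add: chart_measure_def)
  also have "\<dots> = (\<integral>\<^sup>+x\<in>chart_img c. ennreal (volume_density h c x) * indicator B (chart_inv c x) \<partial>lborel)"
    using B by (intro nn_integral_chart_measure c) auto
  also have "\<dots> = (\<integral>\<^sup>+x\<in>chart_map c ` (chart_dom c \<inter> B). ennreal (volume_density h c x) \<partial>lborel)"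
    by (intro nn_integral_cong) (auto simp: chart_map_image_eq[OF c] indicator_def)
  finally show ?thesis .
qed

lemma sets_chart_measure [simp]: "sets (chart_measure h c) = sets surface_borel"
  by (simp add: chart_measure_def)

lemma volume_density_transform: 
  assumes "c \<in> \<A>" "d \<in> \<A>" "x \<in> overlap c d"
  shows "volume_density h c x = \<bar>det (jacobian c d x)\<bar> * volume_density h d (transition c d x)"
  unfolding volume_density_def metric_transform[OF assms]
  by (simp add: det_mul det_transpose real_sqrt_mult mult.commute)

lemma transition_inverse:
  assumes c: "c \<in> \<A>" and d: "d \<in> \<A>" and x: "x \<in> overlap c d"
  shows "transition d c (transition c d x) = x"
  using x by (auto simp: in_overlap_iff[OF c] transition_def d)

lemma has_derivative_transition:
  assumes c: "c \<in> \<A>" and d: "d \<in> \<A>" and x: "x \<in> overlap c d"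
  shows "(transition c d has_derivative frechet_derivative (transition c d) (at x)) (at x)"
  using smooth_on_has_derivative[OF smooth_transition[OF c d] x] .

text \<open>Change of variables along the transition map: by the transformation law of the metric,
  sqrt(det h) picks up exactly the absolute Jacobian determinant.\<close>

lemma emeasure_chart_measure_eq:
  assumes c: "c \<in> \<A>" and d: "d \<in> \<A>" and B: "B \<in> sets surface_borel" "B \<subseteq> chart_dom c" "B \<subseteq> chart_dom d"
  shows "emeasure (chart_measure h c) B = emeasure (chart_measure h d) B"
proof -
  let ?S = "chart_map c ` B" and ?T = "chart_map d ` B"
  have S: "?S = chart_map c ` (chart_dom c \<inter> B)" and T: "?T = chart_map d ` (chart_dom d \<inter> B)"
    using B by (simp_all add: Int_absorb1)
  have Ssub: "?S \<subseteq> overlap c d" and Tsub: "?T \<subseteq> overlap d c"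
    using B by (auto simp: overlap_def)
  have meas: "(\<lambda>x. volume_density h e x * indicator (chart_map e ` B) x) \<in> borel_measurable borel"
    if "e \<in> \<A>" "B \<subseteq> chart_dom e" for e
  proof -
    have sub: "chart_map e ` B \<subseteq> chart_img e" using that by (auto simp: chart_map_in_img)
    have "chart_map e ` B \<in> sets borel"
      using chart_image_borel[OF that(1) B(1)] that(2) by (simp add: Int_absorb1)
    then have "(\<lambda>x. indicator (chart_map e ` B) x *\<^sub>R volume_density h e x) \<in> borel_measurable borel"
      using continuous_on_subset[OF continuous_volume_density[OF that(1)] sub]
      by (rule borel_measurable_continuous_on_indicator)
    then show ?thesis by (simp add: mult.commute)
  qed
  have "(\<integral>\<^sup>+x\<in>?S. ennreal (volume_density h c x) \<partial>lborel) = (\<integral>\<^sup>+x\<in>?T. ennreal (volume_density h d x) \<partial>lborel)"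
  proof (rule nn_integral_eq_of_has_integral_iff)
    fix b
    have "((\<lambda>x. \<bar>det (matrix (frechet_derivative (transition c d) (at x)))\<bar> * volume_density h d (transition c d x))
        has_integral b) ?S \<longleftrightarrow> (volume_density h d has_integral b) ?T"
    proof (rule cov_invertible_nonneg_eq)
      fix x assume "x \<in> ?S"
      then have x: "x \<in> overlap c d" using Ssub by blast
      show "(transition c d has_derivative frechet_derivative (transition c d) (at x)) (at x within ?S)"
        using has_derivative_transition[OF c d x] has_derivative_at_withinI by blast
      show "transition c d x \<in> ?T \<and> transition d c (transition c d x) = x"
        using \<open>x \<in> ?S\<close> B transition_inverse[OF c d x] by (auto simp: transition_def c)
    next
      fix y assume "y \<in> ?T"
      then have y: "y \<in> overlap d c" using Tsub by blast
      show "(transition d c has_derivative frechet_derivative (transition d c) (at y)) (at y within ?T)"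
        using has_derivative_transition[OF d c y] has_derivative_at_withinI by blast
      show "transition d c y \<in> ?S \<and> transition c d (transition d c y) = y"
        using \<open>y \<in> ?T\<close> B transition_inverse[OF d c y] by (auto simp: transition_def d)
      show "0 \<le> volume_density h d y"
        using y volume_density_pos[OF d] by (auto simp: in_overlap_iff[OF d] less_imp_le)
      define x where "x = transition d c y"
      have x: "x \<in> overlap c d" "transition c d x = y"
        using transition_in_overlap[OF d c y] transition_inverse[OF d c y] by (auto simp: x_def)
      \<comment> \<open>The chain rule for the composite of the two transitions, which is the
        identity on an open set, shows that their derivatives are inverse to each other.\<close>
      have "((transition d c \<circ> transition c d) has_derivative
          (frechet_derivative (transition d c) (at y) \<circ> frechet_derivative (transition c d) (at x))) (at x)"
        using has_derivative_transition[OF c d x(1)] has_derivative_transition[OF d c y] x(2)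
        by (intro diff_chain_at) auto
      then have "(id has_derivative
          (frechet_derivative (transition d c) (at y) \<circ> frechet_derivative (transition c d) (at x))) (at x)"
        by (rule has_derivative_transform_within_open[OF _ open_overlap[OF c d] x(1)])
           (simp add: transition_inverse[OF c d])
      moreover have "(id has_derivative id) (at x)" by (simp add: has_derivative_id)
      ultimately show "frechet_derivative (transition d c) (at y) \<circ>
          frechet_derivative (transition c d) (at (transition d c y)) = id"
        using has_derivative_unique x_def by blast
    qed
    moreover have "((\<lambda>x. \<bar>det (matrix (frechet_derivative (transition c d) (at x)))\<bar> * volume_density h d (transition c d x))
        has_integral b) ?S \<longleftrightarrow> (volume_density h c has_integral b) ?S"
      using volume_density_transform[OF c d] Ssub by (intro has_integral_cong) (auto simp: jacobian_def)
    ultimately show "(volume_density h c has_integral b) ?S \<longleftrightarrow> (volume_density h d has_integral b) ?T"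
      by simp
  next
    show "(\<lambda>x. volume_density h c x * indicator ?S x) \<in> borel_measurable borel" by (rule meas[OF c B(2)])
    show "(\<lambda>x. volume_density h d x * indicator ?T x) \<in> borel_measurable borel" by (rule meas[OF d B(3)])
    show "0 \<le> volume_density h c x" if "x \<in> ?S" for x
      using that B(2) by (auto intro!: less_imp_le volume_density_pos c chart_map_in_img)
    show "0 \<le> volume_density h d x" if "x \<in> ?T" for x
      using that B(3) by (auto intro!: less_imp_le volume_density_pos d chart_map_in_img)
  qed
  then show ?thesis
    unfolding emeasure_chart_measure[OF c B(1)] emeasure_chart_measure[OF d B(1)] S[symmetric] T[symmetric] .
qed

text \<open>Each cell of the partition is measured in its own chart and the results are added. For a
  set inside the domain of \<open>d\<close>, every summand may be recomputed in \<open>d\<close>, so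
  the sum collapses to the prescribed integral.\<close>

lemma volume_spec_exists: "\<exists>\<mu>. volume_spec h \<mu>"
proof -
  obtain n :: nat and c D where D: "\<And>i. i < n \<Longrightarrow> c i \<in> \<A>" "\<And>i. i < n \<Longrightarrow> D i \<in> sets surface_borel"
    "\<And>i. i < n \<Longrightarrow> D i \<subseteq> chart_dom (c i)" "disjoint_family_on D {..<n}" "topspace X = (\<Union>i<n. D i)"
    using chart_partition by metis
  define m where "m B = (\<Sum>i<n. emeasure (chart_measure h (c i)) (B \<inter> D i))" for B
  define \<mu> where "\<mu> = measure_of (topspace X) (sets surface_borel) m"
  have sets_\<mu>: "sets \<mu> = sets surface_borel" and space_\<mu>: "space \<mu> = topspace X"
    using sets.space_closed[of surface_borel] sets.sigma_sets_eq[of surface_borel]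
    by (auto simp: \<mu>_def sets_measure_of_conv space_measure_of_conv)
  have em: "emeasure \<mu> B = m B" if "B \<in> sets surface_borel" for B
    unfolding \<mu>_def
  proof (rule emeasure_measure_of_sigma)
    show "sigma_algebra (topspace X) (sets surface_borel)"
      using sets.sigma_algebra_axioms[of surface_borel] by simp
    show "positive (sets surface_borel) m" by (simp add: positive_def m_def)
    show "countably_additive (sets surface_borel) m"
    proof (rule countably_additiveI)
      fix E :: "nat \<Rightarrow> 'a set" assume E: "range E \<subseteq> sets surface_borel" "disjoint_family E"
      have "suminf (\<lambda>j. emeasure (chart_measure h (c i)) (E j \<inter> D i)) =
          emeasure (chart_measure h (c i)) ((\<Union>j. E j) \<inter> D i)" if "i < n" for i
      proof -
        have "suminf (\<lambda>j. emeasure (chart_measure h (c i)) (E j \<inter> D i)) =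
            emeasure (chart_measure h (c i)) (\<Union>j. E j \<inter> D i)"
          using E D(2)[OF that] by (intro suminf_emeasure) (auto simp: disjoint_family_on_def)
        then show ?thesis by (simp add: Int_commute)
      qed
      then show "suminf (\<lambda>j. m (E j)) = m (\<Union>j. E j)"
        unfolding m_def by (subst suminf_sum) auto
    qed
  qed (rule that)
  have "emeasure \<mu> B = (\<integral>\<^sup>+x\<in>chart_map d ` B. ennreal (sqrt (det (h d x))) \<partial>lborel)"
    if d: "d \<in> \<A>" and B: "B \<in> sets surface_borel" "B \<subseteq> chart_dom d" for d B
  proof -
    have "m B = (\<Sum>i<n. emeasure (chart_measure h d) (B \<inter> D i))"
      unfolding m_def
    proof (intro sum.cong refl)
      fix i assume "i \<in> {..<n}"
      then have i: "i < n" by simp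
      show "emeasure (chart_measure h (c i)) (B \<inter> D i) = emeasure (chart_measure h d) (B \<inter> D i)"
        by (rule emeasure_chart_measure_eq) (use d B D(1-3)[OF i] in auto)
    qed
    also have "\<dots> = emeasure (chart_measure h d) (\<Union>i<n. B \<inter> D i)"
      using D(2,4) B by (intro sum_emeasure) (auto simp: disjoint_family_on_def)
    also have "(\<Union>i<n. B \<inter> D i) = B"
      using D(5) sets.sets_into_space[OF B(1)] by auto
    also have "emeasure (chart_measure h d) B = (\<integral>\<^sup>+x\<in>chart_map d ` B. ennreal (sqrt (det (h d x))) \<partial>lborel)"
      using emeasure_chart_measure[OF d B(1)] B(2) by (simp add: Int_absorb1 volume_density_def)
    finally show ?thesis using em[OF B(1)] by simp
  qed
  then have "volume_spec h \<mu>"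
    by (simp add: volume_spec_def sets_\<mu> space_\<mu> sets_surface_borel[symmetric])
  then show ?thesis by blast
qed

abbreviation vol :: "'a measure" where "vol \<equiv> volume_measure X \<A> h"

lemma volume_spec_vol: "volume_spec h vol"
  unfolding volume_measure_eq using volume_spec_exists volume_spec_unique by (metis theI')

lemma space_vol [simp]: "space vol = topspace X" and sets_vol [simp, measurable_cong]: "sets vol = sets surface_borel"
  using volume_spec_vol by (auto simp: volume_spec_def sets_surface_borel)

text \<open>Passes from values on sets to an identity of measures, so that integrals over a chart
  domain become weighted Lebesgue integrals.\<close>

lemma density_vol_chart:
  assumes c: "c \<in> \<A>"
  shows "density vol (indicator (chart_dom c)) = chart_measure h c"
proof (rule measure_eqI)
  fix B assume "B \<in> sets (density vol (indicator (chart_dom c)))"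
  then have B: "B \<in> sets surface_borel" by simp
  note dom = chart_dom_sets_surface_borel[OF c]
  have "emeasure (density vol (indicator (chart_dom c))) B = emeasure vol (chart_dom c \<inter> B)"
    using B dom by (subst emeasure_density) (auto simp: indicator_inter_arith[symmetric])
  also have "\<dots> = (\<integral>\<^sup>+x\<in>chart_map c ` (chart_dom c \<inter> B). ennreal (volume_density h c x) \<partial>lborel)"
  proof -
    have "chart_dom c \<inter> B \<in> sets vol" using B dom by auto
    then show ?thesis using volume_spec_vol c unfolding volume_spec_def volume_density_def by blast
  qed
  finally show "emeasure (density vol (indicator (chart_dom c))) B = emeasure (chart_measure h c) B"
    by (simp add: emeasure_chart_measure[OF c B])
qed simp

lemma nn_integral_vol_chart:
  assumes c: "c \<in> \<A>" and F[measurable]: "F \<in> borel_measurable surface_borel"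
  shows "(\<integral>\<^sup>+p\<in>chart_dom c. F p \<partial>vol) =
    (\<integral>\<^sup>+x\<in>chart_img c. ennreal (volume_density h c x) * F (chart_inv c x) \<partial>lborel)"
proof -
  note [measurable] = chart_dom_sets_surface_borel[OF c]
  have "(\<integral>\<^sup>+p\<in>chart_dom c. F p \<partial>vol) = (\<integral>\<^sup>+p. F p \<partial>density vol (indicator (chart_dom c)))"
    by (subst nn_integral_density) (auto simp: mult.commute)
  then show ?thesis by (simp add: density_vol_chart[OF c] nn_integral_chart_measure[OF c F])
qed

text \<open>For 2 by 2 matrices det(f h) = f^2 det h, so the volume density is multiplied by
  \<open>f\<close>. Hence the weighted measure meets the specification for the new metric, and
  uniqueness identifies the two.\<close>

lemma volume_measure_conformal:
  assumes f: "smooth_fun \<A> f" "\<And>p. p \<in> topspace X \<Longrightarrow> f p > 0"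
  shows "volume_measure X \<A> (\<lambda>c x. f (chart_inv c x) *\<^sub>R h c x) = density vol (\<lambda>p. ennreal (f p))"
proof -
  note [measurable] = measurable_smooth_fun[OF f(1)]
  let ?h = "\<lambda>c x. f (chart_inv c x) *\<^sub>R h c x"
  have "emeasure (density vol (\<lambda>p. ennreal (f p))) B = (\<integral>\<^sup>+x\<in>chart_map c ` B. ennreal (sqrt (det (?h c x))) \<partial>lborel)"
    if c: "c \<in> \<A>" and B[measurable]: "B \<in> sets surface_borel" and sub: "B \<subseteq> chart_dom c" for c B
  proof -
    have "emeasure (density vol (\<lambda>p. ennreal (f p))) B = (\<integral>\<^sup>+p\<in>chart_dom c. ennreal (f p) * indicator B p \<partial>vol)"
      using sub by (subst emeasure_density) (auto intro!: nn_integral_cong simp: indicator_def)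
    also have "\<dots> = (\<integral>\<^sup>+x\<in>chart_img c. ennreal (volume_density h c x) *
        (ennreal (f (chart_inv c x)) * indicator B (chart_inv c x)) \<partial>lborel)"
      by (rule nn_integral_vol_chart[OF c]) measurable
    also have "\<dots> = (\<integral>\<^sup>+x\<in>chart_map c ` B. ennreal (sqrt (det (?h c x))) \<partial>lborel)"
    proof (intro nn_integral_cong)
      fix x
      have img: "x \<in> chart_map c ` B \<longleftrightarrow> x \<in> chart_img c \<and> chart_inv c x \<in> B"
        using chart_map_image_eq[OF c, of B] sub by (simp add: Int_absorb1)
      have "sqrt (det (?h c x)) = volume_density h c x * f (chart_inv c x)" if "x \<in> chart_img c"
      proof -
        have pos: "f (chart_inv c x) > 0"
          using f(2) chart_inv_in_dom[OF that] chart_dom_subset[OF c] by blast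
        have "det (?h c x) = det (h c x) * (f (chart_inv c x))\<^sup>2"
          by (simp add: det_2 power2_eq_square algebra_simps)
        then show ?thesis using pos by (simp add: real_sqrt_mult volume_density_def)
      qed
      note eq = this
      show "ennreal (volume_density h c x) * (ennreal (f (chart_inv c x)) * indicator B (chart_inv c x)) *
          indicator (chart_img c) x = ennreal (sqrt (det (?h c x))) * indicator (chart_map c ` B) x"
      proof (cases "x \<in> chart_map c ` B")
        case True
        then have "x \<in> chart_img c" "chart_inv c x \<in> B" using img by auto
        then show ?thesis
          using True eq volume_density_pos[OF c, of x] f(2)[of "chart_inv c x"] chart_inv_in_dom[of x c]
            chart_dom_subset[OF c] by (auto simp: ennreal_mult)
      next
        case False
        then have "x \<notin> chart_img c \<or> chart_inv c x \<notin> B" using img by auto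
        then show ?thesis using False by auto
      qed
    qed
    finally show ?thesis .
  qed
  then have "volume_spec ?h (density vol (\<lambda>p. ennreal (f p)))"
    by (simp add: volume_spec_def sets_surface_borel[symmetric])
  then show ?thesis
    unfolding volume_measure_eq[of ?h] using volume_spec_unique by blast
qed

text \<open>Each point has a coordinate ball on which the volume density is bounded; finitely many
  such balls cover.\<close>

lemma finite_vol: "emeasure vol (topspace X) < \<infinity>"
proof -
  have "\<exists>U. openin X U \<and> p \<in> U \<and> emeasure vol U < \<infinity>" if p: "p \<in> topspace X" for p
  proof -
    obtain c where c: "c \<in> \<A>" "p \<in> chart_dom c" using p charts_cover by blast
    obtain r where r: "r > 0" "cball (chart_map c p) r \<subseteq> chart_img c"
      using open_chart_img[OF c(1)] chart_map_in_img[OF c(2)] open_contains_cball by blast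
    let ?U = "{q \<in> chart_dom c. chart_map c q \<in> ball (chart_map c p) r}"
    have U: "openin X ?U" by (rule open_chart_preimage[OF c(1)]) simp
    have "compact (volume_density h c ` cball (chart_map c p) r)"
      by (intro compact_continuous_image continuous_on_subset[OF continuous_volume_density[OF c(1)] r(2)]) auto
    then obtain C where C: "volume_density h c x \<le> C" if "x \<in> cball (chart_map c p) r" for x
      by (meson bdd_above.E bounded_imp_bdd_above compact_imp_bounded imageI)
    have "emeasure vol ?U = (\<integral>\<^sup>+x\<in>chart_map c ` ?U. ennreal (volume_density h c x) \<partial>lborel)"
      using volume_spec_vol c(1) openin_sets_surface_borel[OF U] by (auto simp: volume_spec_def volume_density_def)
    also have "\<dots> \<le> (\<integral>\<^sup>+x. ennreal C * indicator (cball (chart_map c p) r) x \<partial>lborel)"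
      using C by (intro nn_integral_mono) (auto simp: indicator_def intro!: ennreal_leI)
    also have "\<dots> = ennreal C * emeasure lborel (cball (chart_map c p) r)"
      by (rule nn_integral_cmult_indicator) simp
    also have "\<dots> < \<infinity>" using emeasure_lborel_cball_finite ennreal_mult_less_top
      by (auto simp: ennreal_mult_less_top)
    finally show ?thesis using U c(2) r(1) by (intro exI[of _ ?U]) auto
  qed
  then obtain n :: nat and U where U: "\<And>i. i < n \<Longrightarrow> openin X (U i)"
      "\<And>i. i < n \<Longrightarrow> emeasure vol (U i) < \<infinity>" "topspace X = (\<Union>i<n. U i)"
    using finite_subcover[of "\<lambda>U. emeasure vol U < \<infinity>"] by metis
  have "emeasure vol (\<Union>i<n. U i) \<le> (\<Sum>i<n. emeasure vol (U i))"
    using U(1) openin_sets_surface_borel by (intro emeasure_subadditive_finite) auto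
  also have "\<dots> < \<infinity>" using U(2) by auto
  finally show ?thesis using U(3) by simp
qed

end

section \<open>Magnetic energy density\<close>

text \<open>\<open>matrix_inv\<close> is a choice among two-sided inverses; uniqueness of inverses
  lets any exhibited one be used.\<close>

lemma matrix_inv_eq:
  fixes H :: "real^'n^'n"
  assumes "H ** B = mat 1" "B ** H = mat 1"
  shows "matrix_inv H = B"
proof -
  have "H ** matrix_inv H = mat 1 \<and> matrix_inv H ** H = mat 1"
    unfolding matrix_inv_def by (rule someI[of _ B]) (simp add: assms)
  then show ?thesis
    by (metis assms(2) matrix_mul_assoc matrix_mul_lid matrix_mul_rid)
qed

lemma matrix_inv_cancel:
  fixes H :: "real^'n^'n"
  assumes "det H \<noteq> 0"
  shows "H ** matrix_inv H = mat 1" "matrix_inv H ** H = mat 1"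
proof -
  obtain B where "H ** B = mat 1" "B ** H = mat 1"
    using assms by (auto simp: invertible_det_nz[symmetric] invertible_def)
  then show "H ** matrix_inv H = mat 1" "matrix_inv H ** H = mat 1"
    using matrix_inv_eq[of H B] by simp_all
qed

lemma matrix_inv_vector:
  fixes H :: "real^'n^'n"
  assumes "det H \<noteq> 0"
  shows "H *v (matrix_inv H *v a) = a" "matrix_inv H *v (H *v a) = a"
  using matrix_inv_cancel[OF assms] by (simp_all add: matrix_vector_mul_assoc)

lemma matrix_inv_scaleR:
  fixes H :: "real^'n^'n"
  assumes "det H \<noteq> 0" "k \<noteq> 0"
  shows "matrix_inv (k *\<^sub>R H) = (1 / k) *\<^sub>R matrix_inv H"
  using matrix_inv_cancel[OF assms(1)] assms(2)
  by (intro matrix_inv_eq) (simp_all add: matrix_scalar_ac scalar_matrix_assoc[symmetric])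

text \<open>The Hermitian form of a real symmetric or non-symmetric matrix, after taking real parts,
  splits into the same real form on the real and the imaginary part. Real estimates then apply to
  each part.\<close>

lemma covector_norm2_eq:
  "covector_norm2 H \<omega> = (\<chi> i. Re (\<omega> $ i)) \<bullet> (matrix_inv H *v (\<chi> i. Re (\<omega> $ i)))
     + (\<chi> i. Im (\<omega> $ i)) \<bullet> (matrix_inv H *v (\<chi> i. Im (\<omega> $ i)))"
  unfolding covector_norm2_def
  by (simp add: inner_vec_def matrix_vector_mult_def sum_2 algebra_simps)

lemma covector_norm2_scaleR:
  "det H \<noteq> 0 \<Longrightarrow> k \<noteq> 0 \<Longrightarrow> covector_norm2 (k *\<^sub>R H) \<omega> = covector_norm2 H \<omega> / k"
  unfolding covector_norm2_def by (simp add: matrix_inv_scaleR sum_divide_distrib)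

lemma posdef_inv_nonneg:
  assumes "posdef H"
  shows "0 \<le> a \<bullet> (matrix_inv H *v a)"
proof -
  let ?y = "matrix_inv H *v a"
  have "H *v ?y = a" using det_pos_if_posdef[OF assms] by (simp add: matrix_inv_vector(1))
  then have "a \<bullet> ?y = ?y \<bullet> (H *v ?y)" by (simp add: inner_commute)
  also have "\<dots> \<ge> 0" using assms by (cases "?y = 0") (auto simp: posdef_def less_imp_le)
  finally show ?thesis .
qed

text \<open>Replaces an eigenvalue argument: with y = H^-1 a, expand |a - m y|^2 \<ge> 0 and use m
  |y|^2 \<le> a . y.\<close>

lemma posdef_inv_le:
  assumes H: "posdef H" and m: "m > 0" "\<And>v. m * (v \<bullet> v) \<le> v \<bullet> (H *v v)"
  shows "a \<bullet> (matrix_inv H *v a) \<le> (a \<bullet> a) / m"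
proof -
  let ?y = "matrix_inv H *v a"
  have "H *v ?y = a" using det_pos_if_posdef[OF H] by (simp add: matrix_inv_vector(1))
  then have 1: "m * (?y \<bullet> ?y) \<le> a \<bullet> ?y" using m(2)[of ?y] by (simp add: inner_commute)
  have "0 \<le> (a - m *\<^sub>R ?y) \<bullet> (a - m *\<^sub>R ?y)" by simp
  also have "\<dots> = a \<bullet> a - 2 * m * (a \<bullet> ?y) + m * (m * (?y \<bullet> ?y))"
    by (simp add: inner_diff_left inner_diff_right inner_commute algebra_simps)
  also have "\<dots> \<le> a \<bullet> a - 2 * m * (a \<bullet> ?y) + m * (a \<bullet> ?y)"
    using 1 m(1) by (intro add_left_mono mult_left_mono) auto
  finally show ?thesis using m(1) by (simp add: field_simps)
qed

lemma covector_norm2_nonneg: "posdef H \<Longrightarrow> 0 \<le> covector_norm2 H \<omega>"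
  unfolding covector_norm2_eq by (simp add: posdef_inv_nonneg)

text \<open>Instead of inverting the product, solve for y = H'^-1 J^T a: cancelling J^T gives J y =
  H^-1 a, and J^T moves across the inner product.\<close>

lemma inner_inv_congruence:
  fixes H J :: "real^'n^'n"
  assumes H': "H' = transpose J ** H ** J" and "det H \<noteq> 0" "det H' \<noteq> 0"
  shows "(transpose J *v a) \<bullet> (matrix_inv H' *v (transpose J *v a)) = a \<bullet> (matrix_inv H *v a)"
proof -
  let ?y = "matrix_inv H' *v (transpose J *v a)"
  have "det (transpose J) \<noteq> 0"
    using assms by (auto simp: det_mul det_transpose)
  moreover have "transpose J *v (H *v (J *v ?y)) = transpose J *v a"
    using matrix_inv_vector(1)[OF assms(3), of "transpose J *v a"] unfolding H' matrix_vector_mul_assoc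
    by (simp only: matrix_mul_assoc)
  ultimately have "H *v (J *v ?y) = a"
    using matrix_inv_vector(2)[of "transpose J"] by metis
  then have "J *v ?y = matrix_inv H *v a"
    using matrix_inv_vector(2)[OF assms(2)] by metis
  then show ?thesis by (simp add: dot_lmul_matrix)
qed

lemma covector_norm2_congruence:
  assumes "H' = transpose J ** H ** J" "det H \<noteq> 0" "det H' \<noteq> 0"
    and \<omega>': "\<And>i. \<omega>' $ i = (\<Sum>j\<in>UNIV. of_real (J $ j $ i) * \<omega> $ j)"
  shows "covector_norm2 H' \<omega>' = covector_norm2 H \<omega>"
proof -
  have "(\<chi> i. Re (\<omega>' $ i)) = transpose J *v (\<chi> i. Re (\<omega> $ i))"
    "(\<chi> i. Im (\<omega>' $ i)) = transpose J *v (\<chi> i. Im (\<omega> $ i))"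
    by (simp_all only: \<omega>' vec_eq_iff) (simp_all add: matrix_vector_mult_def transpose_def del: transpose_matrix_vector)
  then show ?thesis
    unfolding covector_norm2_eq using inner_inv_congruence[OF assms(1-3)] by simp
qed

text \<open>The quadratic form attains a positive minimum on \<open>K\<close> times the unit sphere;
  homogeneity extends the bound to all vectors.\<close>

lemma posdef_lower_bound:
  fixes H :: "'a::metric_space \<Rightarrow> real^2^2"
  assumes K: "compact K" and cont: "continuous_on K H" and pd: "\<And>x. x \<in> K \<Longrightarrow> posdef (H x)"
  obtains m where "m > 0" "\<And>x v. x \<in> K \<Longrightarrow> m * (v \<bullet> v) \<le> v \<bullet> (H x *v v)"
proof (cases "K = {}")
  case True
  then show thesis using that[of 1] by simp
next
  case False
  let ?Q = "\<lambda>z. snd z \<bullet> (H (fst z) *v snd z)"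
  let ?S = "K \<times> sphere (0 :: real^2) 1"
  have "axis 1 1 \<in> sphere (0 :: real^2) 1" by simp
  then have "?S \<noteq> {}" using False by blast
  moreover have "continuous_on ?S (\<lambda>z. H (fst z))"
    by (rule continuous_on_compose2[OF cont continuous_on_fst[OF continuous_on_id]]) auto
  then have "continuous_on ?S ?Q"
    unfolding inner_vec_def matrix_vector_mult_def by (auto intro!: continuous_intros)
  moreover have "compact ?S" by (intro compact_Times K compact_sphere)
  ultimately obtain z where z: "z \<in> ?S" "\<And>y. y \<in> ?S \<Longrightarrow> ?Q z \<le> ?Q y"
    using continuous_attains_inf[of ?S ?Q] by blast
  have "snd z \<noteq> 0" using z(1) by auto
  then have "?Q z > 0" using pd[of "fst z"] z(1) by (auto simp: posdef_def)
  moreover have "?Q z * (v \<bullet> v) \<le> v \<bullet> (H x *v v)" if "x \<in> K" for x v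
  proof (cases "v = 0")
    case False
    let ?w = "(1 / norm v) *\<^sub>R v"
    have "?Q z \<le> ?Q (x, ?w)" using z(2)[of "(x, ?w)"] that False by simp
    also have "\<dots> = (v \<bullet> (H x *v v)) / (v \<bullet> v)"
      using False by (simp add: matrix_vector_mult_scaleR power2_norm_eq_inner[symmetric] power2_eq_square)
    finally show ?thesis using False by (simp add: field_simps)
  qed simp
  ultimately show thesis by (rule that)
qed

section \<open>Chart independence and conformal scaling of the energy density\<close>

context compact_surface
begin

lemma partial_chart_change:
  fixes u :: "'a \<Rightarrow> complex"
  assumes c: "c \<in> \<A>" and d: "d \<in> \<A>" and x: "x \<in> overlap c d" and u: "smooth_fun \<A> u"
  shows "partial (u \<circ> chart_inv c) i x =
    (\<Sum>j\<in>UNIV. of_real (jacobian c d x $ j $ i) * partial (u \<circ> chart_inv d) j (transition c d x))"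
proof -
  let ?T = "transition c d" and ?U = "u \<circ> chart_inv d"
  let ?DT = "frechet_derivative ?T (at x)" and ?DU = "frechet_derivative ?U (at (?T x))"
  have T: "(?T has_derivative ?DT) (at x)"
    using smooth_on_has_derivative[OF smooth_transition[OF c d] x] .
  have Tx: "?T x \<in> chart_img d"
    using transition_in_overlap[OF c d x] by (simp add: in_overlap_iff[OF d])
  have U: "(?U has_derivative ?DU) (at (?T x))"
    using u d Tx smooth_on_has_derivative unfolding smooth_fun_def by blast
  have "((?U \<circ> ?T) has_derivative (?DU \<circ> ?DT)) (at x)"
    using T U by (rule diff_chain_at)
  then have "((u \<circ> chart_inv c) has_derivative (?DU \<circ> ?DT)) (at x)"
    by (rule has_derivative_transform_within_open[OF _ open_overlap[OF c d] x])
       (simp add: chart_inv_transition[OF c d])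
  then have "partial (u \<circ> chart_inv c) i x = ?DU (?DT (axis i 1))"
    using frechet_derivative_at unfolding partial_def by (metis comp_apply)
  also have "?DT (axis i 1) = (\<Sum>j\<in>UNIV. jacobian c d x $ j $ i *\<^sub>R axis j 1)"
    using basis_expansion[of "?DT (axis i 1)"]
    by (simp add: jacobian_def matrix_def scalar_mult_eq_scaleR)
  also have "?DU \<dots> = (\<Sum>j\<in>UNIV. jacobian c d x $ j $ i *\<^sub>R ?DU (axis j 1))"
    by (simp only: linear_sum[OF has_derivative_linear[OF U]] linear_scale[OF has_derivative_linear[OF U]])
  finally show ?thesis
    unfolding partial_def by (simp add: scaleR_conv_of_real)
qed

lemma magnetic_diff_chart_change:
  assumes A: "one_form \<A> A" and c: "c \<in> \<A>" and d: "d \<in> \<A>" and x: "x \<in> overlap c d"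
    and u: "smooth_fun \<A> u"
  shows "magnetic_diff A u c x $ i =
    (\<Sum>j\<in>UNIV. of_real (jacobian c d x $ j $ i) * magnetic_diff A u d (transition c d x) $ j)"
proof -
  have "A c x = transpose (jacobian c d x) *v A d (transition c d x)"
    using A c d x by (auto simp: one_form_def)
  then have "A c x $ i = (\<Sum>j\<in>UNIV. jacobian c d x $ j $ i * A d (transition c d x) $ j)"
    by (simp add: matrix_vector_mult_def transpose_def del: transpose_matrix_vector)
  then show ?thesis
    unfolding magnetic_diff_def
    by (simp add: partial_chart_change[OF c d x u] chart_inv_transition[OF c d x] sum_2 algebra_simps)
qed

end

context riemannian_surface
begin

lemma det_metric_nonzero: "c \<in> \<A> \<Longrightarrow> x \<in> chart_img c \<Longrightarrow> det (h c x) \<noteq> 0"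
  using det_pos_if_posdef[OF posdef_metric, of c x] by auto

lemma some_chart:
  assumes "p \<in> topspace X"
  shows "(SOME c. c \<in> \<A> \<and> p \<in> chart_dom c) \<in> \<A>" "p \<in> chart_dom (SOME c. c \<in> \<A> \<and> p \<in> chart_dom c)"
proof -
  have "\<exists>c. c \<in> \<A> \<and> p \<in> chart_dom c" using assms charts_cover by blast
  then have "(SOME c. c \<in> \<A> \<and> p \<in> chart_dom c) \<in> \<A> \<and> p \<in> chart_dom (SOME c. c \<in> \<A> \<and> p \<in> chart_dom c)"
    by (rule someI_ex)
  then show "(SOME c. c \<in> \<A> \<and> p \<in> chart_dom c) \<in> \<A>" "p \<in> chart_dom (SOME c. c \<in> \<A> \<and> p \<in> chart_dom c)"
    by auto
qed

text \<open>The density is defined in a chosen chart. Metric and covector both transform by the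
  Jacobian, and these factors cancel in the norm, so any chart around \<open>p\<close> may be
  used.\<close>

lemma energy_density_chart:
  assumes A: "one_form \<A> A" and d: "d \<in> \<A>" and p: "p \<in> chart_dom d" and u: "smooth_fun \<A> u"
  shows "magnetic_energy_density \<A> h A u p =
    covector_norm2 (h d (chart_map d p)) (magnetic_diff A u d (chart_map d p))"
proof -
  define c where "c = (SOME c. c \<in> \<A> \<and> p \<in> chart_dom c)"
  have c: "c \<in> \<A>" "p \<in> chart_dom c"
    using some_chart[of p] p chart_dom_subset[OF d] by (auto simp: c_def)
  define x where "x = chart_map c p"
  have x: "x \<in> overlap c d" using c p by (auto simp: x_def overlap_def)
  have Tx: "transition c d x = chart_map d p" using c by (simp add: x_def transition_def)
  have "covector_norm2 (h c x) (magnetic_diff A u c x) =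
      covector_norm2 (h d (transition c d x)) (magnetic_diff A u d (transition c d x))"
    by (rule covector_norm2_congruence[OF metric_transform[OF c(1) d x] _ _
          magnetic_diff_chart_change[OF A c(1) d x u]])
       (use c d p in \<open>auto simp: x_def Tx[unfolded x_def] det_metric_nonzero chart_map_in_img\<close>)
  then show ?thesis
    unfolding magnetic_energy_density_def c_def[symmetric] by (simp add: x_def[symmetric] Let_def Tx)
qed

lemma energy_density_nonneg:
  assumes "p \<in> topspace X"
  shows "0 \<le> magnetic_energy_density \<A> h A u p"
  unfolding magnetic_energy_density_def Let_def
  using some_chart[OF assms] by (intro covector_norm2_nonneg posdef_metric chart_map_in_img) auto

text \<open>The chart chosen at \<open>p\<close> depends on the atlas and \<open>p\<close> only, so
  both sides use the same one. The factor 1/f of the inverse metric later cancels the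
  \<open>f\<close> of the volume.\<close>

lemma energy_density_conformal:
  assumes "p \<in> topspace X" "f p > 0"
  shows "magnetic_energy_density \<A> (\<lambda>c x. f (chart_inv c x) *\<^sub>R h c x) A u p =
    magnetic_energy_density \<A> h A u p / f p"
  unfolding magnetic_energy_density_def Let_def
  using some_chart[OF assms(1)] assms(2)
  by (simp add: covector_norm2_scaleR det_metric_nonzero chart_map_in_img)

end

section \<open>Concentrating the conformal factor\<close>

lemma smooth_grad2_plus_square:
  assumes "smooth_on UNIV v"
  shows "smooth_on UNIV (\<lambda>x. grad2 v x + (v x)\<^sup>2)"
  unfolding grad2_def partial_def power2_eq_square
  by (intro smooth_on_add smooth_on_sum smooth_on_bilinear[OF bounded_bilinear_mult]
      smooth_on_frechet_derivative assms) auto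

lemma grad2_outside:
  assumes "compact K" "\<And>x. x \<notin> K \<Longrightarrow> v x = 0" "x \<notin> K"
  shows "grad2 v x = 0"
proof -
  have "partial v i x = 0" for i
    by (rule partial_locally_const[of "- K" x v 0]) (use assms in \<open>auto simp: compact_imp_closed open_Compl\<close>)
  then show ?thesis by (simp add: grad2_def)
qed

context compact_surface
begin

text \<open>For real \<open>v\<close> the differential of \<open>v\<close> is the real part and -vA
  the imaginary part, so the two never mix in the energy.\<close>

lemma magnetic_diff_zero_ext:
  assumes c: "c \<in> \<A>" and v: "smooth_on UNIV v" and x: "x \<in> chart_img c"
  shows "magnetic_diff A (zero_ext c (\<lambda>x. complex_of_real (v x))) c x $ i =
    Complex (partial v i x) (- (v x * A c x $ i))"
proof -
  let ?u = "zero_ext c (\<lambda>x. complex_of_real (v x))"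
  have "((\<lambda>x. complex_of_real (v x)) has_derivative (\<lambda>h. of_real (frechet_derivative v (at x) h))) (at x)"
    by (rule has_derivative_of_real[OF smooth_on_has_derivative[OF v UNIV_I]])
  then have "((?u \<circ> chart_inv c) has_derivative (\<lambda>h. of_real (frechet_derivative v (at x) h))) (at x)"
    by (rule has_derivative_transform_within_open[OF _ open_chart_img[OF c] x]) (simp add: zero_ext_chart_inv)
  then have "frechet_derivative (?u \<circ> chart_inv c) (at x) = (\<lambda>h. of_real (frechet_derivative v (at x) h))"
    using frechet_derivative_at by metis
  then show ?thesis
    unfolding magnetic_diff_def by (simp add: partial_def zero_ext_chart_inv[OF x] complex_eq_iff)
qed

end

context riemannian_surface
begin

text \<open>On the image of \<open>K\<close> the inverse metric is at most 1/m and |A|^2 at most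
  \<open>a\<close>; with a \<ge> 1 one constant serves both the gradient and the potential term. Off
  that closed image the function vanishes near the point, so its energy density is 0.\<close>

lemma energy_density_zero_ext_le:
  assumes A: "one_form \<A> A" and c: "c \<in> \<A>" and K: "compact K" "K \<subseteq> chart_img c"
    and v: "smooth_on UNIV v" "\<And>x. x \<notin> K \<Longrightarrow> v x = 0"
    and m: "m > 0" "\<And>x w. x \<in> K \<Longrightarrow> m * (w \<bullet> w) \<le> w \<bullet> (h c x *v w)"
    and a: "\<And>x. x \<in> K \<Longrightarrow> A c x \<bullet> A c x \<le> a" "a \<ge> 1"
    and p: "p \<in> topspace X"
  shows "magnetic_energy_density \<A> h A (zero_ext c (\<lambda>x. complex_of_real (v x))) p
    \<le> a / m * zero_ext c (\<lambda>x. grad2 v x + (v x)\<^sup>2) p"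
proof -
  let ?u = "zero_ext c (\<lambda>x. complex_of_real (v x))"
  have cv: "smooth_on UNIV (\<lambda>x. complex_of_real (v x))"
    by (rule smooth_on_compose[OF _ v(1) smooth_on_linear[OF bounded_linear_of_real]]) auto
  have u: "smooth_fun \<A> ?u"
    by (rule smooth_zero_ext[OF c K cv]) (simp add: v(2))
  show ?thesis
  proof (cases "p \<in> chart_inv c ` K")
    case True
    then obtain x where x: "x \<in> K" "p = chart_inv c x" by blast
    then have img: "x \<in> chart_img c" using K by blast
    have pd: "p \<in> chart_dom c" "chart_map c p = x"
      using chart_inv_in_dom[OF img] img x(2) by auto
    let ?re = "\<chi> i. partial v i x" and ?im = "(- v x) *\<^sub>R A c x"
    have "magnetic_energy_density \<A> h A ?u p = covector_norm2 (h c x) (magnetic_diff A ?u c x)"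
      using energy_density_chart[OF A c pd(1) u] pd(2) by simp
    also have "\<dots> = ?re \<bullet> (matrix_inv (h c x) *v ?re) + ?im \<bullet> (matrix_inv (h c x) *v ?im)"
      unfolding covector_norm2_eq magnetic_diff_zero_ext[OF c v(1) img]
      by (simp add: vec_eq_iff scaleR_vec_def)
    also have "\<dots> \<le> (?re \<bullet> ?re) / m + (?im \<bullet> ?im) / m"
      by (intro add_mono posdef_inv_le posdef_metric c img m x)
    also have "\<dots> = (grad2 v x + (v x)\<^sup>2 * (A c x \<bullet> A c x)) / m"
      by (simp add: grad2_def inner_vec_def power2_eq_square add_divide_distrib sum_2 algebra_simps)
    also have "\<dots> \<le> (grad2 v x * a + (v x)\<^sup>2 * a) / m"
    proof -
      have "grad2 v x * 1 \<le> grad2 v x * a"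
        using a(2) by (intro mult_left_mono) (auto simp: grad2_def sum_nonneg)
      then show ?thesis
        using m(1) a(1)[OF x(1)] by (intro divide_right_mono add_mono mult_left_mono) auto
    qed
    also have "\<dots> = a / m * zero_ext c (\<lambda>x. grad2 v x + (v x)\<^sup>2) p"
      using pd by (simp add: zero_ext_def field_simps)
    finally show ?thesis .
  next
    case False
    obtain d where d: "d \<in> \<A>" "p \<in> chart_dom d" using p charts_cover by blast
    let ?V = "chart_map d ` (chart_dom d \<inter> (topspace X - chart_inv c ` K))"
    have V: "open ?V"
      by (intro open_chart_image d openin_diff openin_topspace closedin_chart_inv_image c K)
    have zero: "?u q = 0" if "q \<notin> chart_inv c ` K" for q
      using zero_ext_eq_0[OF c that, of "\<lambda>x. complex_of_real (v x)"] v(2) by simp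
    have "chart_map d p \<in> ?V" using False p d by blast
    then have "partial (?u \<circ> chart_inv d) i (chart_map d p) = 0" for i
      by (rule partial_locally_const[OF V]) (use zero in \<open>auto simp: chart_map_image_eq[OF d(1)]\<close>)
    then have "magnetic_diff A ?u d (chart_map d p) = 0"
      using zero[OF False] d unfolding magnetic_diff_def by (simp add: vec_eq_iff)
    then have "magnetic_energy_density \<A> h A ?u p = 0"
      using energy_density_chart[OF A d u] by (simp add: covector_norm2_def)
    moreover have "0 \<le> zero_ext c (\<lambda>x. grad2 v x + (v x)\<^sup>2) p"
      by (auto simp: zero_ext_def grad2_def sum_nonneg)
    ultimately show ?thesis using m(1) a(2) by simp
  qed
qed

lemma nn_integral_zero_ext:
  fixes w :: "real^2 \<Rightarrow> real"
  assumes c: "c \<in> \<A>" and K: "compact K" "K \<subseteq> chart_img c"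
    and w: "smooth_on UNIV w" "\<And>x. x \<notin> K \<Longrightarrow> w x = 0"
  shows "(\<integral>\<^sup>+p. ennreal (zero_ext c w p) \<partial>vol) =
    (\<integral>\<^sup>+x\<in>chart_img c. ennreal (volume_density h c x) * ennreal (w x) \<partial>lborel)"
proof -
  note [measurable] = measurable_smooth_fun[OF smooth_zero_ext[OF c K w]]
  have "(\<integral>\<^sup>+p. ennreal (zero_ext c w p) \<partial>vol) = (\<integral>\<^sup>+p\<in>chart_dom c. ennreal (zero_ext c w p) \<partial>vol)"
    by (intro nn_integral_cong) (auto simp: zero_ext_def indicator_def)
  also have "\<dots> = (\<integral>\<^sup>+x\<in>chart_img c. ennreal (volume_density h c x) * ennreal (zero_ext c w (chart_inv c x)) \<partial>lborel)"
    by (rule nn_integral_vol_chart[OF c]) measurable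
  also have "\<dots> = (\<integral>\<^sup>+x\<in>chart_img c. ennreal (volume_density h c x) * ennreal (w x) \<partial>lborel)"
    by (intro nn_integral_cong) (auto simp: indicator_def zero_ext_chart_inv)
  finally show ?thesis .
qed

lemma finite_measure_vol: "finite_measure vol"
  by (rule finite_measureI) (use finite_vol in auto)

lemma integrable_smooth_fun:
  fixes f :: "'a \<Rightarrow> real"
  assumes "smooth_fun \<A> f"
  shows "integrable vol f"
proof -
  have meas: "f \<in> borel_measurable vol" using measurable_smooth_fun[OF assms] by simp
  have "\<exists>U. openin X U \<and> p \<in> U \<and> (\<exists>C. \<forall>q\<in>U. \<bar>f q\<bar> \<le> C)" if "p \<in> topspace X" for p
    using openin_smooth_preimage[OF assms open_ball[of "f p" 1]] that
    by (intro exI[of _ "{q \<in> topspace X. f q \<in> ball (f p) 1}"] conjI exI[of _ "\<bar>f p\<bar> + 1"])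
       (auto simp: dist_real_def)
  then obtain n :: nat and U where U: "\<And>i. i < n \<Longrightarrow> openin X (U i)"
      "\<And>i. i < n \<Longrightarrow> \<exists>C. \<forall>q\<in>U i. \<bar>f q\<bar> \<le> C" "topspace X = (\<Union>i<n. U i)"
    using finite_subcover[of "\<lambda>U. \<exists>C. \<forall>q\<in>U. \<bar>f q\<bar> \<le> C"] by metis
  have "\<forall>i. \<exists>C. i < n \<longrightarrow> (\<forall>q\<in>U i. \<bar>f q\<bar> \<le> C)" using U(2) by blast
  from choice[OF this] obtain C where C: "\<forall>i. i < n \<longrightarrow> (\<forall>q\<in>U i. \<bar>f q\<bar> \<le> C i)"
    by (rule exE)
  have "\<bar>f q\<bar> \<le> (\<Sum>i<n. \<bar>C i\<bar>)" if q: "q \<in> topspace X" for q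
  proof -
    \<comment> \<open>The sum of the local bounds serves as one global bound, since each of them is
      one of its nonnegative terms.\<close>
    obtain i where i: "i < n" "q \<in> U i" using q U(3) by blast
    then have "\<bar>f q\<bar> \<le> \<bar>C i\<bar>" using C by (meson abs_ge_self order_trans)
    also have "\<dots> \<le> (\<Sum>i<n. \<bar>C i\<bar>)" using i by (intro member_le_sum) auto
    finally show ?thesis .
  qed
  then show ?thesis
    by (intro finite_measure.integrable_const_bound[OF finite_measure_vol _ meas, of "\<Sum>i<n. \<bar>C i\<bar>"] AE_I2) auto
qed

text \<open>A real infimum is informative only for a nonempty family that is bounded below: the
  constant function 1 and nonnegativity of the quotients supply this.\<close>

lemma lambda1_conformal:
  assumes "topspace X \<noteq> {}" and h': "h' \<in> conformal_class X \<A> h"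
  shows "0 \<le> lambda1 X \<A> h' A" and "smooth_fun \<A> u \<Longrightarrow> \<exists>p\<in>topspace X. u p \<noteq> 0 \<Longrightarrow>
    lambda1 X \<A> h' A \<le> rayleigh_quotient X \<A> h' A u"
proof -
  obtain f :: "'a \<Rightarrow> real" where f: "smooth_fun \<A> f" "\<And>p. p \<in> topspace X \<Longrightarrow> f p > 0"
      "h' = (\<lambda>c x. f (chart_inv c x) *\<^sub>R h c x)"
    using h' by (auto simp: conformal_class_def)
  have vol': "volume_measure X \<A> h' = density vol (\<lambda>p. ennreal (f p))"
    unfolding f(3) by (rule volume_measure_conformal[OF f(1,2)])
  have rq: "0 \<le> rayleigh_quotient X \<A> h' A u" for u
    unfolding rayleigh_quotient_def vol' unfolding f(3)
    using f(2) energy_density_nonneg energy_density_conformal[of _ f]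
    by (intro divide_nonneg_nonneg integral_nonneg_AE AE_I2) (auto simp: less_imp_le)
  have "(\<lambda>_. 1) \<in> {u :: 'a \<Rightarrow> complex. smooth_fun \<A> u \<and> (\<exists>p\<in>topspace X. u p \<noteq> 0)}"
  proof -
    obtain p where "p \<in> topspace X" using assms(1) by blast
    then show ?thesis using smooth_fun_const by auto
  qed
  then show "0 \<le> lambda1 X \<A> h' A"
    unfolding lambda1_def by (intro cINF_greatest rq) blast
  show "lambda1 X \<A> h' A \<le> rayleigh_quotient X \<A> h' A u"
    if "smooth_fun \<A> u" "\<exists>p\<in>topspace X. u p \<noteq> 0"
    unfolding lambda1_def using that rq by (intro cINF_lower bdd_belowI2[of _ 0]) auto
qed

lemma area_conformal:
  assumes f: "smooth_fun \<A> f" "\<And>p. p \<in> topspace X \<Longrightarrow> f p > 0"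
  shows "area X \<A> (\<lambda>c x. f (chart_inv c x) *\<^sub>R h c x) = (\<integral>p. f p \<partial>vol)"
proof -
  have vol': "volume_measure X \<A> (\<lambda>c x. f (chart_inv c x) *\<^sub>R h c x) = density vol (\<lambda>p. ennreal (f p))"
    by (rule volume_measure_conformal[OF f])
  have meas: "f \<in> borel_measurable vol" using measurable_smooth_fun[OF f(1)] by simp
  have pos: "AE p in vol. 0 \<le> f p" using f(2) by (intro AE_I2) (auto simp: less_imp_le)
  have "emeasure (density vol (\<lambda>p. ennreal (f p))) (topspace X) = (\<integral>\<^sup>+p. ennreal (f p) \<partial>vol)"
    using meas by (subst emeasure_density) (auto intro!: nn_integral_cong sets.top[of surface_borel, simplified])
  also have "\<dots> = ennreal (\<integral>p. f p \<partial>vol)"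
    by (rule nn_integral_eq_integral[OF integrable_smooth_fun[OF f(1)] pos])
  finally show ?thesis
    unfolding area_def vol' measure_def
    using integral_nonneg_AE[OF pos] by simp
qed

text \<open>On the small ball the volume density has a positive minimum, so the integral is at least
  this minimum times the area of the ball.\<close>

lemma nn_integral_bump_pos:
  assumes c: "c \<in> \<A>" and K: "compact K" "K \<subseteq> chart_img c"
    and w: "smooth_on UNIV w" "\<And>x. x \<notin> K \<Longrightarrow> w x = 0"
    and s: "s > 0" "cball x0 s \<subseteq> K" "\<And>x. x \<in> cball x0 s \<Longrightarrow> w x \<ge> 1"
  shows "(\<integral>\<^sup>+p. ennreal (zero_ext c w p) \<partial>vol) > 0"
proof -
  have sub: "cball x0 s \<subseteq> chart_img c" using s(2) K(2) by blast
  obtain y where y: "y \<in> cball x0 s" "\<And>x. x \<in> cball x0 s \<Longrightarrow> volume_density h c y \<le> volume_density h c x"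
    using continuous_attains_inf[of "cball x0 s" "volume_density h c"]
      continuous_on_subset[OF continuous_volume_density[OF c] sub] s(1) by auto
  have "0 < ennreal (volume_density h c y) * emeasure lborel (cball x0 s)"
    using volume_density_pos[OF c, of y] y(1) sub s(1)
    by (auto simp: emeasure_cball ennreal_zero_less_mult_iff unit_ball_vol_pos)
  also have "\<dots> = (\<integral>\<^sup>+x. ennreal (volume_density h c y) * indicator (cball x0 s) x \<partial>lborel)"
    by (rule nn_integral_cmult_indicator[symmetric]) simp
  also have "\<dots> \<le> (\<integral>\<^sup>+x\<in>chart_img c. ennreal (volume_density h c x) * ennreal (w x) \<partial>lborel)"
  proof (rule nn_integral_mono)
    fix x
    show "ennreal (volume_density h c y) * indicator (cball x0 s) x \<le>
        ennreal (volume_density h c x) * ennreal (w x) * indicator (chart_img c) x"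
    proof (cases "x \<in> cball x0 s")
      case True
      then have "ennreal (volume_density h c y) * 1 \<le> ennreal (volume_density h c x) * ennreal (w x)"
        using y(2)[OF True] s(3)[OF True] by (intro mult_mono ennreal_leI) (auto simp: ennreal_leI)
      then show ?thesis using True sub by (simp add: subset_iff)
    qed simp
  qed
  also have "\<dots> = (\<integral>\<^sup>+p. ennreal (zero_ext c w p) \<partial>vol)"
    by (rule nn_integral_zero_ext[OF c K w, symmetric])
  finally show ?thesis .
qed

lemma exists_small_conformal:
  assumes A: "one_form \<A> A" and ne: "topspace X \<noteq> {}" and e: "e > 0"
  shows "\<exists>h'\<in>conformal_class X \<A> h. area X \<A> h' * lambda1 X \<A> h' A \<le> e"
proof -
  obtain p0 where p0: "p0 \<in> topspace X" using ne by blast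
  obtain c where c: "c \<in> \<A>" "p0 \<in> chart_dom c" using p0 charts_cover by blast
  define x0 where "x0 = chart_map c p0"
  have x0: "x0 \<in> chart_img c" using c by (simp add: x0_def chart_map_in_img)
  obtain r where r: "r > 0" "cball x0 r \<subseteq> chart_img c"
    using open_chart_img[OF c(1)] x0 open_contains_cball by blast
  define K where "K = cball x0 r"
  have K: "compact K" "K \<subseteq> chart_img c" using r by (auto simp: K_def)
  have bound: "\<exists>C\<ge>1. \<forall>x\<in>K. g x \<le> C" if "continuous_on (chart_img c) g" for g :: "real^2 \<Rightarrow> real"
  proof -
    have "compact (g ` K)"
      by (intro compact_continuous_image continuous_on_subset[OF that K(2)] K)
    then obtain C where "\<And>x. x \<in> K \<Longrightarrow> g x \<le> C"
      by (meson bdd_above.E bounded_imp_bdd_above compact_imp_bounded imageI)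
    then show ?thesis by (intro exI[of _ "max 1 C"]) (auto intro: max.coboundedI2)
  qed
  have contA: "continuous_on (chart_img c) (A c)"
    using A c(1) smooth_on_continuous unfolding one_form_def by blast
  obtain a where a: "a \<ge> 1" "\<And>x. x \<in> K \<Longrightarrow> A c x \<bullet> A c x \<le> a"
    using bound[of "\<lambda>x. A c x \<bullet> A c x"] contA by (auto intro: continuous_intros)
  obtain D where D: "D \<ge> 1" "\<And>x. x \<in> K \<Longrightarrow> volume_density h c x \<le> D"
    using bound[OF continuous_volume_density[OF c(1)]] by auto
  obtain m where m: "m > 0" "\<And>x w. x \<in> K \<Longrightarrow> m * (w \<bullet> w) \<le> w \<bullet> (h c x *v w)"
    using posdef_lower_bound[OF K(1) continuous_on_subset[OF smooth_on_continuous[OF smooth_metric[OF c(1)]] K(2)]]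
      posdef_metric[OF c(1)] K(2) by (metis subsetD)
  define C where "C = a / m"
  have C: "C > 0" using a m by (simp add: C_def)
  \<comment> \<open>Makes the last product 2 P (C D \<epsilon>) / P equal to \<open>e\<close>.
    \<open>C\<close> and \<open>D\<close> depend only on the chart ball, so \<epsilon> can be fixed
    before \<open>v\<close> exists.\<close>
  define \<epsilon> where "\<epsilon> = e / (2 * C * D)"
  have \<epsilon>: "\<epsilon> > 0" using e C D by (simp add: \<epsilon>_def)
  obtain s v where s: "s > 0" and v: "smooth_on UNIV v" "\<And>x. 0 \<le> v x" "\<And>x. v x \<le> 1"
      "\<And>x. x \<notin> K \<Longrightarrow> v x = 0" "\<And>x. x \<in> cball x0 s \<Longrightarrow> v x = 1"
      "(\<integral>\<^sup>+x. ennreal (grad2 v x + (v x)\<^sup>2) \<partial>lborel) \<le> ennreal \<epsilon>"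
    by (rule point_capacity_zero[OF r(1) \<epsilon>, of x0, folded K_def]) (rule that)
  define w where "w x = grad2 v x + (v x)\<^sup>2" for x
  have w: "smooth_on UNIV w" "\<And>x. x \<notin> K \<Longrightarrow> w x = 0" "\<And>x. 0 \<le> w x"
    using smooth_grad2_plus_square[OF v(1)] grad2_outside[OF K(1) v(4)] v(4)
    by (auto simp: w_def[abs_def] grad2_def sum_nonneg)
  let ?W = "zero_ext c w"
  have W: "smooth_fun \<A> ?W" "\<And>p. 0 \<le> ?W p"
    using smooth_zero_ext[OF c(1) K w(1,2)] w(3) by (auto simp: zero_ext_def)
  have intW: "(\<integral>p. ?W p \<partial>vol) \<le> D * \<epsilon>"
  proof -
    have "ennreal (\<integral>p. ?W p \<partial>vol) = (\<integral>\<^sup>+p. ennreal (?W p) \<partial>vol)"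
      using W by (intro nn_integral_eq_integral[symmetric] integrable_smooth_fun) auto
    also have "\<dots> = (\<integral>\<^sup>+x\<in>chart_img c. ennreal (volume_density h c x) * ennreal (w x) \<partial>lborel)"
      by (rule nn_integral_zero_ext[OF c(1) K w(1,2)])
    also have "\<dots> \<le> (\<integral>\<^sup>+x. ennreal D * ennreal (w x) \<partial>lborel)"
    proof (rule nn_integral_mono)
      fix x show "ennreal (volume_density h c x) * ennreal (w x) * indicator (chart_img c) x \<le> ennreal D * ennreal (w x)"
        using D(2)[of x] w(2)[of x]
        by (cases "x \<in> K") (auto simp: indicator_def intro!: mult_right_mono ennreal_leI)
    qed
    also have "\<dots> = ennreal D * (\<integral>\<^sup>+x. ennreal (w x) \<partial>lborel)"
      using borel_measurable_continuous_onI[OF smooth_on_continuous[OF w(1)]]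
      by (intro nn_integral_cmult) simp
    also have "\<dots> \<le> ennreal D * ennreal \<epsilon>"
      using v(6) by (intro mult_left_mono) (auto simp: w_def)
    also have "\<dots> = ennreal (D * \<epsilon>)" using D \<epsilon> by (simp add: ennreal_mult)
    finally show ?thesis using D \<epsilon> by (simp add: ennreal_le_iff)
  qed
  \<comment> \<open>\<open>s\<close> keeps the bump where \<open>v\<close> is 1, and
    \<open>r\<close> keeps it inside \<open>K\<close>.\<close>
  define t where "t = min s r"
  have t: "t > 0" using s r by (simp add: t_def)
  define \<psi> where "\<psi> x = cutoff ((1 / t) *\<^sub>R (x - x0))" for x
  have norm_t: "norm ((1 / t) *\<^sub>R (x - x0)) = dist x0 x / t" for x
    using t by (simp add: dist_norm norm_minus_commute)
  have \<psi>: "smooth_on UNIV \<psi>" "\<And>x. x \<notin> cball x0 t \<Longrightarrow> \<psi> x = 0" "\<And>x. 0 \<le> \<psi> x"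
    "\<And>x. x \<in> cball x0 (t / 2) \<Longrightarrow> 1 \<le> \<psi> x"
  proof -
    have "smooth_on UNIV (\<lambda>x. (1 / t) *\<^sub>R x + (1 / t) *\<^sub>R (- x0))"
      by (intro smooth_on_add smooth_on_linear smooth_on_const bounded_linear_scaleR_right) auto
    then have "smooth_on UNIV (\<lambda>x. (1 / t) *\<^sub>R (x - x0))" by (simp add: scaleR_diff_right)
    then show "smooth_on UNIV \<psi>"
      unfolding \<psi>_def[abs_def] by (intro smooth_on_compose[OF _ _ smooth_cutoff]) auto
    show "\<psi> x = 0" if "x \<notin> cball x0 t" for x
    proof -
      have "1 \<le> dist x0 x / t" using that t by (simp add: field_simps)
      then show ?thesis unfolding \<psi>_def norm_t[symmetric] by (rule cutoff_eq_0)
    qed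
    show "1 \<le> \<psi> x" if "x \<in> cball x0 (t / 2)" for x
    proof -
      have "dist x0 x / t \<le> 1/2" using that t by (simp add: field_simps)
      then show ?thesis unfolding \<psi>_def norm_t[symmetric] by (simp only: cutoff_eq_1)
    qed
  qed (simp add: \<psi>_def cutoff_bounds)
  have tK: "cball x0 t \<subseteq> K" by (auto simp: K_def t_def)
  have \<psi>K: "\<And>x. x \<notin> K \<Longrightarrow> \<psi> x = 0" using \<psi>(2) tK by blast
  let ?\<Psi> = "zero_ext c \<psi>"
  have \<Psi>: "smooth_fun \<A> ?\<Psi>" "\<And>p. 0 \<le> ?\<Psi> p"
    using smooth_zero_ext[OF c(1) K \<psi>(1) \<psi>K] \<psi>(3) by (auto simp: zero_ext_def)
  define P where "P = (\<integral>p. ?\<Psi> p \<partial>vol)"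
  have "P > 0"
  proof -
    have "ennreal P = (\<integral>\<^sup>+p. ennreal (?\<Psi> p) \<partial>vol)"
      unfolding P_def using \<Psi> by (intro nn_integral_eq_integral[symmetric] integrable_smooth_fun) auto
    also have "\<dots> > 0"
      by (rule nn_integral_bump_pos[OF c(1) K \<psi>(1) \<psi>K, of "t / 2" x0])
         (use t tK \<psi>(4) in \<open>auto simp: subset_iff\<close>)
    finally show ?thesis by simp
  qed
  define M where "M = measure vol (topspace X)"
  \<comment> \<open>The background \<delta> then adds at most \<open>P\<close> to the area; the 1 in
    the denominator rules out division by zero.\<close>
  define \<delta> where "\<delta> = P / (M + 1)"
  have M: "M \<ge> 0" by (simp add: M_def)
  have \<delta>: "\<delta> > 0" "\<delta> * M \<le> P" using \<open>P > 0\<close> M by (simp_all add: \<delta>_def field_simps)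
  define f where "f p = \<delta> + ?\<Psi> p" for p
  have f: "smooth_fun \<A> f" "\<And>p. f p > 0"
    using smooth_fun_add[OF smooth_fun_const \<Psi>(1)] \<Psi>(2) \<delta>(1) by (auto simp: f_def[abs_def] add_pos_nonneg)
  define h' where "h' = (\<lambda>d x. f (chart_inv d x) *\<^sub>R h d x)"
  have h': "h' \<in> conformal_class X \<A> h"
    using f by (auto simp: conformal_class_def h'_def)
  have vol': "volume_measure X \<A> h' = density vol (\<lambda>p. ennreal (f p))"
    unfolding h'_def by (rule volume_measure_conformal[OF f])
  have f_meas: "f \<in> borel_measurable vol" using measurable_smooth_fun[OF f(1)] by simp
  have f_AE: "AE p in vol. 0 \<le> f p" using f(2) by (intro AE_I2) (simp add: less_imp_le)
  interpret vol: finite_measure vol by (rule finite_measure_vol)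
  have area: "area X \<A> h' \<le> 2 * P"
  proof -
    have "area X \<A> h' = (\<integral>p. \<delta> + ?\<Psi> p \<partial>vol)"
      unfolding h'_def by (simp add: area_conformal[OF f]) (simp add: f_def)
    also have "\<dots> = \<delta> * M + P"
      unfolding P_def by (subst Bochner_Integration.integral_add)
        (auto intro: integrable_smooth_fun \<Psi> simp: M_def)
    finally show ?thesis using \<delta>(2) by simp
  qed
  let ?u = "zero_ext c (\<lambda>x. complex_of_real (v x))"
  have cv: "smooth_on UNIV (\<lambda>x. complex_of_real (v x))"
    by (rule smooth_on_compose[OF _ v(1) smooth_on_linear[OF bounded_linear_of_real]]) auto
  have u: "smooth_fun \<A> ?u"
    by (rule smooth_zero_ext[OF c(1) K cv]) (simp add: v(4))
  have u_p0: "\<exists>p\<in>topspace X. ?u p \<noteq> 0"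
    using p0 c v(5)[of x0] s by (intro bexI[of _ p0]) (simp_all add: zero_ext_def x0_def)
  let ?N = "\<integral>p. magnetic_energy_density \<A> h' A ?u p \<partial>density vol (\<lambda>p. ennreal (f p))"
  let ?L = "\<integral>p. (cmod (?u p))\<^sup>2 \<partial>density vol (\<lambda>p. ennreal (f p))"
  have N: "?N \<le> C * (D * \<epsilon>)"
  proof -
    have W_meas: "?W \<in> borel_measurable vol" using measurable_smooth_fun[OF W(1)] by simp
    \<comment> \<open>Conformal invariance in use: the weight \<open>f\<close> of the measure
      cancels the 1/f of the energy density.\<close>
    have fWf: "f p * (C * ?W p / f p) = C * ?W p" for p using f(2)[of p] by simp
    have CW: "integrable vol (\<lambda>p. C * ?W p)" using integrable_smooth_fun[OF W(1)] by simp
    \<comment> \<open>Only the majorant has to be integrable: if the energy density were not, its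
      integral would be 0 by convention and the bound would still hold.\<close>
    have "?N \<le> (\<integral>p. C * ?W p / f p \<partial>density vol (\<lambda>p. ennreal (f p)))"
    proof (rule integral_mono')
      show "integrable (density vol (\<lambda>p. ennreal (f p))) (\<lambda>p. C * ?W p / f p)"
        using CW by (subst integrable_density[OF _ f_meas f_AE]) (use W_meas f_meas in \<open>simp_all only: real_scaleR_def fWf, measurable\<close>)
      fix p assume "p \<in> space (density vol (\<lambda>p. ennreal (f p)))"
      then have p: "p \<in> topspace X" by simp
      have "magnetic_energy_density \<A> h' A ?u p = magnetic_energy_density \<A> h A ?u p / f p"
        unfolding h'_def by (rule energy_density_conformal[where f = f, OF p f(2)])
      also have "\<dots> \<le> C * ?W p / f p"
        using energy_density_zero_ext_le[OF A c(1) K v(1,4) m a(2,1) p] f(2)[of p]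
        by (intro divide_right_mono) (auto simp: C_def w_def[abs_def])
      finally show "magnetic_energy_density \<A> h' A ?u p \<le> C * ?W p / f p" .
      show "0 \<le> C * ?W p / f p" using C W(2)[of p] f(2)[of p] by simp
    qed
    also have "\<dots> = (\<integral>p. C * ?W p \<partial>vol)"
      by (subst integral_density[OF _ f_meas f_AE]) (use W_meas f_meas in \<open>simp_all only: real_scaleR_def fWf, measurable\<close>)
    also have "\<dots> = C * (\<integral>p. ?W p \<partial>vol)" by simp
    also have "\<dots> \<le> C * (D * \<epsilon>)" using intW C by simp
    finally show ?thesis .
  qed
  have L: "P \<le> ?L"
  proof -
    have u_meas: "?u \<in> borel_measurable vol" using measurable_smooth_fun[OF u] by simp
    have vu: "(cmod (?u p))\<^sup>2 = zero_ext c (\<lambda>x. v x * v x) p" for p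
      by (simp add: zero_ext_def power2_eq_square abs_mult[symmetric] v(2))
    \<comment> \<open>Written as one extension by zero, \<open>f\<close> times the square of |u| is
      seen to be smooth and hence integrable.\<close>
    have "smooth_on UNIV (\<lambda>x. \<delta> * (v x * v x) + \<psi> x * (v x * v x))"
      by (intro smooth_on_add smooth_on_bilinear[OF bounded_bilinear_mult] smooth_on_const v \<psi>) auto
    from smooth_zero_ext[OF c(1) K this]
    have "smooth_fun \<A> (zero_ext c (\<lambda>x. \<delta> * (v x * v x) + \<psi> x * (v x * v x)))" by (simp add: v(4))
    then have "integrable vol (zero_ext c (\<lambda>x. \<delta> * (v x * v x) + \<psi> x * (v x * v x)))"
      by (rule integrable_smooth_fun)
    moreover have "zero_ext c (\<lambda>x. \<delta> * (v x * v x) + \<psi> x * (v x * v x)) = (\<lambda>p. f p * (cmod (?u p))\<^sup>2)"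
      unfolding vu by (rule ext) (simp add: zero_ext_def f_def algebra_simps)
    ultimately have int: "integrable vol (\<lambda>p. f p * (cmod (?u p))\<^sup>2)" by (simp only:)
    have "P \<le> (\<integral>p. f p * (cmod (?u p))\<^sup>2 \<partial>vol)"
      unfolding P_def
    proof (rule integral_mono[OF integrable_smooth_fun[OF \<Psi>(1)] int])
      fix p
      \<comment> \<open>On the support of the bump \<open>v\<close> is 1, so nothing of its mass
        \<open>P\<close> is lost in the denominator.\<close>
      have "?\<Psi> p = ?\<Psi> p * (cmod (?u p))\<^sup>2"
      proof (cases "p \<in> chart_dom c \<and> chart_map c p \<in> cball x0 t")
        case True
        then have "v (chart_map c p) = 1" by (intro v(5)) (simp add: t_def)
        then show ?thesis using True by (simp add: zero_ext_def)
      next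
        case False
        then show ?thesis using \<psi>(2)[of "chart_map c p"] by (auto simp: zero_ext_def)
      qed
      also have "\<dots> \<le> f p * (cmod (?u p))\<^sup>2"
        using \<delta>(1) by (intro mult_right_mono) (auto simp: f_def)
      finally show "?\<Psi> p \<le> f p * (cmod (?u p))\<^sup>2" .
    qed
    also have "\<dots> = ?L"
      using u_meas f_meas f_AE by (subst integral_density) auto
    finally show ?thesis .
  qed
  have "lambda1 X \<A> h' A \<le> ?N / ?L"
    using lambda1_conformal(2)[OF ne h' u u_p0] by (simp add: rayleigh_quotient_def vol')
  also have "\<dots> \<le> C * (D * \<epsilon>) / P"
    using N L \<open>P > 0\<close> C D \<epsilon> by (intro frac_le) auto
  \<comment> \<open>\<open>P\<close> cancels, so it does not matter how little mass the bump
    carries, although the bump depends on \<epsilon> through \<open>v\<close>.\<close>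
  finally have "area X \<A> h' * lambda1 X \<A> h' A \<le> 2 * P * (C * (D * \<epsilon>) / P)"
    using area \<open>P > 0\<close> lambda1_conformal(1)[OF ne h'] by (intro mult_mono) auto
  also have "\<dots> = e" using \<open>P > 0\<close> C D by (simp add: \<epsilon>_def)
  finally show ?thesis using h' by blast
qed

end

theorem theorem25:
  fixes X :: "'a topology" and \<A> :: "'a chart set" and g :: nat
    and h :: "'a metric_field" and A :: "'a form"
  assumes "g \<ge> 1"
    and "smooth_surface X \<A>"
    and "compact_space X" and "connected_space X"
    and "orientable X \<A>"
    and "has_genus X g"
    and "riemannian_metric \<A> h"
    and "closed_one_form \<A> A"
  shows "(INF h'\<in>conformal_class X \<A> h. area X \<A> h' * lambda1 X \<A> h' A) = 0"
proof -
  interpret riemannian_surface X \<A> h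
    by unfold_locales (fact assms)+
  have A: "one_form \<A> A"
    using assms(8) by (simp add: closed_one_form_def)
  let ?F = "\<lambda>h'. area X \<A> h' * lambda1 X \<A> h' A"
  have "h \<in> conformal_class X \<A> h"
    unfolding conformal_class_def using smooth_fun_const[of "1 :: real"] by (auto intro!: exI[of _ "\<lambda>_. 1"])
  then have ne: "conformal_class X \<A> h \<noteq> {}" by blast
  show ?thesis
  proof (cases "topspace X = {}")
    \<comment> \<open>Here every area is the measure of the empty set, so the infimum is that of the
      constant family 0.\<close>
    case True
    then have "?F = (\<lambda>h'. 0)" by (simp add: area_def)
    from trans[OF arg_cong[OF this, of "\<lambda>F. Inf (F ` conformal_class X \<A> h)"] cINF_const[OF ne]]
    show ?thesis .
  next
    case False
    have nonneg: "0 \<le> ?F h'" if "h' \<in> conformal_class X \<A> h" for h'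
      using lambda1_conformal(1)[OF False that] by (simp add: area_def)
    show ?thesis
    proof (rule antisym)
      show "0 \<le> (INF h'\<in>conformal_class X \<A> h. ?F h')"
        by (rule cINF_greatest[OF ne nonneg])
      show "(INF h'\<in>conformal_class X \<A> h. ?F h') \<le> 0"
      \<comment> \<open>No single metric need reach 0; each \<open>e > 0\<close> gets its own, and
        the lower bound 0 makes the infimum at most its value.\<close>
      proof (rule field_le_epsilon)
        fix e :: real assume "e > 0"
        then obtain h' where "h' \<in> conformal_class X \<A> h" "?F h' \<le> e"
          using exists_small_conformal[OF A False] by blast
        then show "(INF h'\<in>conformal_class X \<A> h. ?F h') \<le> 0 + e"
          using nonneg by (intro cINF_lower2[where x = h'] bdd_belowI2[of _ 0]) auto
      qed
    qed
  qed
qed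

end
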